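(* Let $d\ge2$, let $q$ be a prime power with $d\mid q-1$, and let $\varphi_d\in\widehat{\mathbb{F}_q^\times}$ be a character of exact order $d$. Let $a,b,c\in\mathbb{Z}/d\mathbb{Z}$ satisfy $a,b\notin\{0,c\}$, $c\neq0$ and $$c-a-b=\frac{d(d-1)}{2}\mod d.$$ Then for every $\lambda\in\mathbb{F}_q^\times-\mu_d$ and every $r\ge1$, $$F(\widetilde{\varphi}_d^{\,a},\widetilde{\varphi}_d^{\,b};\widetilde\varepsilon,\widetilde{\varphi}_d^{\,c};\lambda^d)_{q^r}=P_r\Big(F(\varphi_d^a,\varphi_d^b;\varepsilon,\varphi_d^c;\lambda^d)_q,\ \tfrac12\Big(F(\varphi_d^a,\varphi_d^b;\varepsilon,\varphi_d^c;\lambda^d)_q^2-F(\widetilde{\varphi}_d^{\,a},\widetilde{\varphi}_d^{\,b};\widetilde\varepsilon,\widetilde{\varphi}_d^{\,c};\lambda^d)_{q^2}\Big)\Big),$$ where $P_r\in\mathbb{Z}[x,y]$ is the unique polynomial satisfying $P_r(\alpha+\beta,\alpha\beta)=\alpha^r+\beta^r$.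
   Context: $\mu_d\subset\mathbb{F}_q^\times$ is the group of $d$th roots of unity. For a finite field $k$ with $Q$ elements let $\widehat{k^\times}=\mathrm{Hom}(k^\times,\overline{\mathbb{Q}}^\times)$, with trivial character $\varepsilon$; put $\eta(0)=0$ for every $\eta\in\widehat{k^\times}$ (including $\varepsilon$), and $\delta(\eta)=1$ if $\eta=\varepsilon$, $\delta(\eta)=0$ otherwise. Fix a nontrivial additive character $\psi$ of $k$ and put $g(\eta)=-\sum_{x\in k^\times}\eta(x)\psi(x)$, $g^\circ(\eta)=Q^{\delta(\eta)}g(\eta)$, $(\alpha)_\nu=g(\alpha\nu)/g(\alpha)$, $(\alpha)_\nu^\circ=g^\circ(\alpha\nu)/g^\circ(\alpha)$. For characters $\alpha_i,\beta_i\in\widehat{k^\times}$ and $z\in k$, $$F(\alpha_1,\dots,\alpha_m;\beta_1,\dots,\beta_m;z)_Q=\frac{1}{1-Q}\sum_{\nu\in\widehat{k^\times}}\frac{(\alpha_1)_\nu\cdots(\alpha_m)_\nu}{(\beta_1)^\circ_\nu\cdots(\beta_m)^\circ_\nu}\,\nu(z)$$ (the value does not depend on $\psi$). For $\eta\in\widehat{\mathbb{F}_q^\times}$ and an extension $\mathbb{F}_{q^s}/\mathbb{F}_q$, $\widetilde{\eta}=\eta\circ\mathrm{N}_{\mathbb{F}_{q^s}/\mathbb{F}_q}\in\widehat{\mathbb{F}_{q^s}^\times}$; the relevant $s$ is indicated by the subscript $q^s$ of $F(\cdots)_{q^s}$. *)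

theory Defs
  imports
    "HOL-Algebra.Algebra"
    "HOL-Algebra.Algebraic_Closure_Type"
    "HOL-Number_Theory.Number_Theory"
begin

text \<open>
  Finite fields are finite subfields of an arbitrary field of type \<open>'a\<close>, so that extensions of
  a finite field are simply larger subfields of the same type.
\<close>

type_synonym qbar = "rat alg_closure"

definition finite_field :: "nat \<Rightarrow> 'a::field set \<Rightarrow> bool" where
  "finite_field Q k \<longleftrightarrow> subfield k ring_of_type_algebra \<and> finite k \<and> card k = Q"

text \<open>
  A multiplicative character is extended by zero to all of \<open>'a\<close>, in particular to \<open>0\<close>. This holds
  for the trivial character too, and makes equality of characters equality of functions.
\<close>

definition mult_chars :: "'a::field set \<Rightarrow> ('a \<Rightarrow> qbar) set" where
  "mult_chars k = {\<eta>. (\<forall>x\<in>k - {0}. \<eta> x \<noteq> 0) \<and> (\<forall>x. x \<notin> k - {0} \<longrightarrow> \<eta> x = 0) \<and>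
                       (\<forall>x\<in>k - {0}. \<forall>y\<in>k - {0}. \<eta> (x * y) = \<eta> x * \<eta> y)}"

definition triv_char :: "'a::field set \<Rightarrow> 'a \<Rightarrow> qbar" where
  "triv_char k = (\<lambda>x. if x \<in> k - {0} then 1 else 0)"

definition char_group :: "'a::field set \<Rightarrow> ('a \<Rightarrow> qbar) monoid" where
  "char_group k = \<lparr>carrier = mult_chars k, monoid.mult = (\<lambda>\<alpha> \<beta> x. \<alpha> x * \<beta> x), monoid.one = triv_char k\<rparr>"

lemma comm_group_char_group:
  assumes "finite_field Q k"
  shows "comm_group (char_group k)"
proof -
  have sr: "subring k ring_of_type_algebra"
    using assms by (simp add: finite_field_def subfield_def subdomain_def subcring_def)
  have mk: "x * y \<in> k - {0}" if "x \<in> k - {0}" "y \<in> k - {0}" for x y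
    using subringE(6)[OF sr, of x y] that by (auto simp: ring_of_type_algebra_def)
  show ?thesis
  proof (rule comm_groupI, goal_cases)
    case (6 \<alpha>)
    then show ?case
      by (intro bexI[of _ "\<lambda>x. inverse (\<alpha> x)"])
         (auto simp: char_group_def mult_chars_def triv_char_def fun_eq_iff)
  qed (use mk in \<open>auto simp: char_group_def mult_chars_def triv_char_def fun_eq_iff\<close>)
qed
text \<open>The values of an additive character outside \<open>k\<close> are irrelevant.\<close>

definition nontriv_add_char :: "'a::field set \<Rightarrow> ('a \<Rightarrow> qbar) \<Rightarrow> bool" where
  "nontriv_add_char k \<psi> \<longleftrightarrow> (\<forall>x\<in>k. \<psi> x \<noteq> 0) \<and> (\<forall>x\<in>k. \<forall>y\<in>k. \<psi> (x + y) = \<psi> x * \<psi> y) \<and>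
                            (\<exists>x\<in>k. \<psi> x \<noteq> 1)"

definition delta_char :: "'a::field set \<Rightarrow> ('a \<Rightarrow> qbar) \<Rightarrow> nat" where
  "delta_char k \<eta> = (if \<eta> = triv_char k then 1 else 0)"

definition gauss :: "'a::field set \<Rightarrow> ('a \<Rightarrow> qbar) \<Rightarrow> ('a \<Rightarrow> qbar) \<Rightarrow> qbar" where
  "gauss k \<psi> \<eta> = - (\<Sum>x\<in>k - {0}. \<eta> x * \<psi> x)"

definition gauss_circ :: "'a::field set \<Rightarrow> ('a \<Rightarrow> qbar) \<Rightarrow> ('a \<Rightarrow> qbar) \<Rightarrow> qbar" where
  "gauss_circ k \<psi> \<eta> = of_nat (card k) ^ delta_char k \<eta> * gauss k \<psi> \<eta>"

definition poch :: "'a::field set \<Rightarrow> ('a \<Rightarrow> qbar) \<Rightarrow> ('a \<Rightarrow> qbar) \<Rightarrow> ('a \<Rightarrow> qbar) \<Rightarrow> qbar" where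
  "poch k \<psi> \<alpha> \<nu> = gauss k \<psi> (\<alpha> \<otimes>\<^bsub>char_group k\<^esub> \<nu>) / gauss k \<psi> \<alpha>"

definition poch_circ :: "'a::field set \<Rightarrow> ('a \<Rightarrow> qbar) \<Rightarrow> ('a \<Rightarrow> qbar) \<Rightarrow> ('a \<Rightarrow> qbar) \<Rightarrow> qbar" where
  "poch_circ k \<psi> \<alpha> \<nu> = gauss_circ k \<psi> (\<alpha> \<otimes>\<^bsub>char_group k\<^esub> \<nu>) / gauss_circ k \<psi> \<alpha>"

definition hypergeom ::
  "'a::field set \<Rightarrow> ('a \<Rightarrow> qbar) \<Rightarrow> ('a \<Rightarrow> qbar) list \<Rightarrow> ('a \<Rightarrow> qbar) list \<Rightarrow> 'a \<Rightarrow> qbar" where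
  "hypergeom k \<psi> \<alpha>s \<beta>s z =
     1 / (1 - of_nat (card k)) *
     (\<Sum>\<nu>\<in>mult_chars k.
        (\<Prod>\<alpha>\<leftarrow>\<alpha>s. poch k \<psi> \<alpha> \<nu>) / (\<Prod>\<beta>\<leftarrow>\<beta>s. poch_circ k \<psi> \<beta> \<nu>) * \<nu> z)"

text \<open>
  The norm from the field with \<open>q ^ s\<close> elements to the field with \<open>q\<close> elements, as the product of
  the conjugates under the powers of the Frobenius map \<open>x \<mapsto> x ^ q\<close>.
\<close>

definition ff_norm :: "nat \<Rightarrow> nat \<Rightarrow> 'a::field \<Rightarrow> 'a" where
  "ff_norm q s x = (\<Prod>i<s. x ^ (q ^ i))"

definition lift_char :: "nat \<Rightarrow> nat \<Rightarrow> 'a::field set \<Rightarrow> ('a \<Rightarrow> qbar) \<Rightarrow> 'a \<Rightarrow> qbar" where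
  "lift_char q s l \<eta> = (\<lambda>x. if x \<in> l then \<eta> (ff_norm q s x) else 0)"

definition mu :: "nat \<Rightarrow> 'a::field set \<Rightarrow> 'a set" where
  "mu d k = {x \<in> k - {0}. x ^ d = 1}"

text \<open>
  \<open>\<int>[x,y]\<close> is represented as \<open>\<int>[x][y]\<close>: the outer variable is \<open>y\<close>, the inner one is \<open>x\<close>.
\<close>

definition eval2 :: "int poly poly \<Rightarrow> 'b::comm_ring_1 \<Rightarrow> 'b \<Rightarrow> 'b" where
  "eval2 P x y = poly (map_poly (\<lambda>p. poly (map_poly of_int p) x) P) y"

text \<open>
  Since \<open>qbar\<close> is infinite, the identity for all values in \<open>qbar\<close> is the identity of polynomials.
\<close>

definition power_sum_poly :: "nat \<Rightarrow> int poly poly" where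
  "power_sum_poly r = (THE P. \<forall>\<alpha> \<beta> :: qbar. eval2 P (\<alpha> + \<beta>) (\<alpha> * \<beta>) = \<alpha> ^ r + \<beta> ^ r)"

end

theory Submission
  imports Defs
begin

text \<open>
  The reason for the theorem is that both sides are traces of Frobenius on a space of dimension two:
  there are \<open>u\<close> and \<open>v\<close> in \<open>qbar\<close>, independent of \<open>s\<close>, such that
  the hypergeometric value over \<open>\<F>(q ^ s)\<close> is \<open>u ^ s + v ^ s\<close>. Then \<open>(F1 ^ 2 - F2) / 2 = u * v\<close>, and
  the power sum polynomial does the rest. The existence of \<open>u\<close> and \<open>v\<close> has an elementary proof.

  On one side, expanding the Gauss sums and summing over \<open>\<nu>\<close> turns the hypergeometric function
  with parameters \<open>\<alpha>, \<beta>; \<epsilon>, \<gamma>\<close> into a quotient of character sums (\<open>hypergeom_2F1_char_sum\<close>):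
  the numerator is the sum over \<open>x\<close> of
  \<open>\<beta> (0 - x) * inverse (\<alpha> (1 - x)) * (\<gamma> / \<beta>) (z - x)\<close>, with the three points \<open>0, 1, z\<close>, and the
  denominator is \<open>\<gamma> z\<close> times a Jacobi sum, with the two points \<open>0, 1\<close>.

  On the other side, fix finitely many points \<open>p\<close> of \<open>\<F>(q)\<close> with a character \<open>\<eta>\<^sub>p\<close> for each, at least
  one of them nontrivial, and let \<open>A n\<close> be the sum of \<open>\<Prod>\<^sub>p \<eta>\<^sub>p (g p)\<close> over the monic polynomials \<open>g\<close>
  of degree \<open>n\<close> over \<open>\<F>(q)\<close>. The series of the \<open>A n\<close> is an L-function, and two facts determine it.
  By Lagrange interpolation \<open>A n = 0\<close> as soon as \<open>n\<close> is at least the number of points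
  (\<open>monic_sum_eq_0\<close>), so the L-function is a polynomial, of degree at most two for three points. Its
  logarithmic derivative comes from counting the roots of every \<open>g\<close> with multiplicity: the \<open>A n\<close> and the sums
  \<open>S s = \<Sum>\<^sub>x \<Prod>\<^sub>p \<eta>\<^sub>p (N (p - x))\<close> over \<open>x\<close> in \<open>\<F>(q ^ s)\<close> are related like elementary symmetric functions
  and power sums (\<open>newton_identity\<close>). Hence \<open>S s = - (\<rho> ^ s + \<sigma> ^ s)\<close> for three points and
  \<open>S s = - (\<rho> ^ s)\<close> for two points, which is the theorem of Hasse and Davenport for the Jacobi sums in the
  denominator, and \<open>S s = 0\<close> for one point, so that the norm pulls nontrivial characters back to
  nontrivial ones. Dividing the first result by the second gives \<open>u\<close> and \<open>v\<close>.
\<close>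

section \<open>Polynomials over algebraically closed fields\<close>

lemma degree_eq_sum_order:
  fixes g :: "'b :: alg_closed_field poly"
  assumes "g \<noteq> 0"
  shows "Polynomial.degree g = (\<Sum>x | poly g x = 0. Polynomial.order x g)"
proof -
  obtain A where A: "size A = Polynomial.degree g"
      "g = smult (lead_coeff g) (\<Prod>x\<in>#A. [:- x, 1:])"
    using alg_closed_imp_factorization[OF assms] by blast
  have nz: "(\<Prod>x\<in>#A. [:- x, 1:]) \<noteq> 0" for A :: "'b multiset"
    by (induction A) (auto simp del: mult_pCons_left)
  have "proots (\<Prod>x\<in>#A. [:- x, 1:]) = A"
  proof (induction A)
    case (add x A)
    have "proots ([:- x, 1:] * (\<Prod>x\<in>#A. [:- x, 1:])) = {#x#} + A"
      using nz[of A] add by (subst proots_mult) (auto simp del: mult_pCons_left)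
    then show ?case by simp
  qed simp
  then have "proots g = A"
    using A(2) assms proots_smult[of "lead_coeff g" "\<Prod>x\<in>#A. [:- x, 1:]"] by simp
  then show ?thesis
    using A(1) assms by (simp add: size_multiset_overloaded_eq flip: count_proots set_count_proots)
qed

lemma prod_linear_dvd:
  fixes g :: "'b :: idom poly"
  assumes "finite A" "inj_on f A" "\<And>i. i \<in> A \<Longrightarrow> poly g (f i) = 0"
  shows "(\<Prod>i\<in>A. [:- f i, 1:]) dvd g"
  using assms
proof (induction A rule: finite_induct)
  case (insert a A)
  then obtain h where h: "g = (\<Prod>i\<in>A. [:- f i, 1:]) * h" by auto
  have "poly (\<Prod>i\<in>A. [:- f i, 1:]) (f a) \<noteq> 0"
    using insert by (auto simp: poly_prod)
  then have "poly h (f a) = 0"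
    using insert.prems(2)[of a] h by simp
  then obtain h' where "h = [:- f a, 1:] * h'" by (auto simp: poly_eq_0_iff_dvd)
  then have "g = (\<Prod>i\<in>insert a A. [:- f i, 1:]) * h'"
    using h insert by (simp add: mult_ac del: mult_pCons_left mult_pCons_right)
  then show ?case by simp
qed simp

section \<open>Monic polynomials over a finite field and their Newton identity\<close>

text \<open>
  The algebraically closed field contains \<open>\<F>(q ^ s)\<close> for every \<open>s\<close>, as the set of fixed points of the
  \<open>s\<close>th power of \<open>x \<mapsto> x ^ q\<close>; that \<open>q\<close> is a power of the characteristic is expressed by the additivity of that map.
\<close>

locale frobenius_field =
  fixes q :: nat and ty :: "'b :: alg_closed_field itself"
  assumes q_gt_1: "q > 1"
    and frob_add: "\<And>x y :: 'b. (x + y) ^ q = x ^ q + y ^ q"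
begin

lemma q_pos [simp]: "0 < q" using q_gt_1 by simp

lemma frob_minus: "(- x :: 'b) ^ q = - (x ^ q)"
  using frob_add[of x "- x"] by (simp add: zero_power eq_neg_iff_add_eq_0 add.commute)

lemma frob_diff: "(x - y :: 'b) ^ q = x ^ q - y ^ q"
  using frob_add[of x "- y"] by (simp add: frob_minus)

lemma frob_sum: "(sum f A :: 'b) ^ q = (\<Sum>i\<in>A. f i ^ q)"
  by (induction A rule: infinite_finite_induct) (auto simp: frob_add zero_power)

lemma frob_inj: "(x :: 'b) ^ q = y ^ q \<Longrightarrow> x = y"
  using frob_diff[of x y] by simp

lemma frob_pow_inj: "(x :: 'b) ^ q ^ i = y ^ q ^ i \<Longrightarrow> x = y"
proof (induction i arbitrary: x y)
  case (Suc i)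
  then have "(x ^ q) ^ q ^ i = (y ^ q) ^ q ^ i" by (simp add: power_mult)
  then have "x ^ q = y ^ q" by (rule Suc.IH)
  then show ?case by (rule frob_inj)
qed simp

definition fixed_field :: "nat \<Rightarrow> 'b set" where
  "fixed_field s = {x. x ^ q ^ s = x}"

definition frob_poly :: "'b poly \<Rightarrow> 'b poly" where
  "frob_poly = map_poly (\<lambda>x. x ^ q)"

text \<open>The polynomials with coefficients in \<open>\<F>(q)\<close>.\<close>

definition fixed_polys :: "'b poly set" where
  "fixed_polys = {g. frob_poly g = g}"

definition monics :: "nat \<Rightarrow> 'b poly set" where
  "monics n = {g \<in> fixed_polys. Polynomial.degree g = n \<and> Polynomial.coeff g n = 1}"

text \<open>
  For \<open>x\<close> in \<open>\<F>(q ^ s)\<close> this is the characteristic polynomial of \<open>x\<close> for the extension \<open>\<F>(q ^ s)\<close> of \<open>\<F>(q)\<close>,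
  that is, the minimal polynomial of \<open>x\<close> to the power \<open>s / e\<close>, where \<open>e\<close> is the degree of \<open>x\<close>.
\<close>

definition conj_poly :: "nat \<Rightarrow> 'b \<Rightarrow> 'b poly" where
  "conj_poly s x = (\<Prod>i<s. [:- (x ^ q ^ i), 1:])"

lemma coeff_frob_poly: "Polynomial.coeff (frob_poly g) i = Polynomial.coeff g i ^ q"
  by (simp add: frob_poly_def coeff_map_poly)

lemma frob_poly_mult: "frob_poly (f * g) = frob_poly f * frob_poly g"
  by (intro poly_eqI) (simp add: coeff_frob_poly coeff_mult frob_sum power_mult_distrib)

lemma frob_poly_add: "frob_poly (f + g) = frob_poly f + frob_poly g"
  by (intro poly_eqI) (simp add: coeff_frob_poly frob_add)

lemma frob_poly_1: "frob_poly 1 = 1"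
  by (simp add: frob_poly_def)

lemma frob_poly_prod: "frob_poly (prod f A) = (\<Prod>i\<in>A. frob_poly (f i))"
  by (induction A rule: infinite_finite_induct) (auto simp: frob_poly_mult frob_poly_1)

lemma frob_poly_linear: "frob_poly [:- x, 1:] = [:- (x ^ q), 1:]"
  by (simp add: frob_poly_def map_poly_pCons frob_minus zero_power)

lemma poly_frob_poly: "poly (frob_poly g) (x ^ q) = poly g x ^ q"
proof -
  have "Polynomial.degree (frob_poly g) = Polynomial.degree g"
    unfolding frob_poly_def by (cases "g = 0") (auto intro!: map_poly_degree_eq)
  then show ?thesis
    by (simp add: poly_altdef frob_sum coeff_frob_poly power_mult_distrib mult.commute flip: power_mult)
qed

lemma fixed_polys_cofactor:
  assumes "f \<in> fixed_polys" "f * h \<in> fixed_polys" "f \<noteq> 0"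
  shows "h \<in> fixed_polys"
  using assms by (simp add: fixed_polys_def frob_poly_mult)

lemma fixed_polys_mult: "f \<in> fixed_polys \<Longrightarrow> g \<in> fixed_polys \<Longrightarrow> f * g \<in> fixed_polys"
  by (simp add: fixed_polys_def frob_poly_mult)

lemma root_frob:
  assumes "g \<in> fixed_polys" "poly g x = 0"
  shows "poly g (x ^ q ^ i) = 0"
proof (induction i)
  case (Suc i)
  have "poly g ((x ^ q ^ i) ^ q) = 0"
    using poly_frob_poly[of g "x ^ q ^ i"] Suc assms by (simp add: fixed_polys_def zero_power)
  then show ?case by (simp add: mult.commute flip: power_mult)
qed (use assms in auto)

lemma poly_fixed:
  assumes "g \<in> fixed_polys" "x \<in> fixed_field 1"
  shows "poly g x \<in> fixed_field 1"
  using poly_frob_poly[of g x] assms by (simp add: fixed_polys_def fixed_field_def)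

lemma conj_poly_nonzero [simp]: "conj_poly s x \<noteq> 0"
  by (simp add: conj_poly_def)

lemma degree_conj_poly [simp]: "Polynomial.degree (conj_poly s x) = s"
  unfolding conj_poly_def by (subst degree_prod_eq_sum_degree) auto

lemma lead_coeff_conj_poly: "Polynomial.coeff (conj_poly s x) s = 1"
proof -
  have "lead_coeff (conj_poly s x) = 1"
    unfolding conj_poly_def by (subst lead_coeff_prod) auto
  then show ?thesis by simp
qed

text \<open>
  The Frobenius map only permutes the factors cyclically, since the last conjugate \<open>x ^ q ^ s\<close> is the
  first one.
\<close>

lemma conj_poly_fixed:
  assumes "x \<in> fixed_field s"
  shows "conj_poly s x \<in> fixed_polys"
proof (cases s)
  case (Suc m)
  have "frob_poly (conj_poly s x) = (\<Prod>i<Suc m. [:- (x ^ q ^ Suc i), 1:])"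
    unfolding conj_poly_def frob_poly_prod frob_poly_linear Suc
    by (simp only: power_Suc mult.commute[of q] power_mult)
  also have "\<dots> = (\<Prod>i<m. [:- (x ^ q ^ Suc i), 1:]) * [:- (x ^ q ^ s), 1:]"
    by (simp add: Suc)
  also have "x ^ q ^ s = x ^ q ^ 0" using assms by (simp add: fixed_field_def)
  also have "(\<Prod>i<m. [:- (x ^ q ^ Suc i), 1:]) * [:- (x ^ q ^ 0), 1:] = conj_poly s x"
    unfolding conj_poly_def Suc prod.lessThan_Suc_shift by (simp only: mult.commute)
  finally show ?thesis by (simp add: fixed_polys_def)
qed (simp add: conj_poly_def fixed_polys_def frob_poly_1)

lemma conj_poly_add:
  assumes "x \<in> fixed_field e"
  shows "conj_poly (e + s) x = conj_poly e x * conj_poly s x"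
proof -
  have "x ^ q ^ (e + i) = x ^ q ^ i" for i
    using assms by (simp add: fixed_field_def power_add power_mult)
  then show ?thesis
    unfolding conj_poly_def
    by (induction s) (simp_all add: mult_ac del: mult_pCons_left mult_pCons_right)
qed

lemma fixed_field_add_iff:
  assumes "x \<in> fixed_field e"
  shows "x \<in> fixed_field (e + s) \<longleftrightarrow> x \<in> fixed_field s"
  using assms by (simp add: fixed_field_def power_add power_mult)

text \<open>
  The roots of \<open>g\<close> are a finite set that is stable under the injective Frobenius map.
\<close>

lemma root_periodic:
  assumes "g \<in> fixed_polys" "g \<noteq> 0" "poly g x = 0"
  shows "\<exists>e>0. x \<in> fixed_field e"
proof -
  have "range (\<lambda>i. x ^ q ^ i) \<subseteq> {y. poly g y = 0}"
    using root_frob assms by auto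
  then have "finite (range (\<lambda>i. x ^ q ^ i))"
    using poly_roots_finite[OF assms(2)] finite_subset by blast
  then have "\<not> inj (\<lambda>i. x ^ q ^ i)" using finite_imageD by blast
  then obtain i j where ij: "x ^ q ^ i = x ^ q ^ j" "i < j"
    by (metis injI linorder_neqE_nat)
  then have "x ^ q ^ i = (x ^ q ^ (j - i)) ^ q ^ i"
    by (simp flip: power_mult power_add)
  then have "x = x ^ q ^ (j - i)" by (rule frob_pow_inj)
  then show ?thesis using ij by (intro exI[of _ "j - i"]) (simp add: fixed_field_def)
qed

text \<open>
  The characteristic polynomials of \<open>x\<close> are the powers of its minimal polynomial, and exactly \<open>m\<close> of
  these powers divide \<open>g\<close> if \<open>m\<close> is the multiplicity of the root \<open>x\<close>. The induction splits off one
  minimal polynomial, which is \<open>conj_poly e x\<close> for the least period \<open>e\<close> of \<open>x\<close>; it has \<open>x\<close> as a simple root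
  because \<open>e\<close> is minimal. This replaces factorisation into irreducible polynomials over \<open>\<F>(q)\<close>.
\<close>

lemma order_eq_card:
  assumes "g \<in> fixed_polys" "g \<noteq> 0"
  shows "Polynomial.order x g = card {s. 1 \<le> s \<and> x \<in> fixed_field s \<and> conj_poly s x dvd g}"
  using assms
proof (induction "Polynomial.order x g" arbitrary: g)
  case 0
  have "{s. 1 \<le> s \<and> x \<in> fixed_field s \<and> conj_poly s x dvd g} = {}"
  proof (safe, goal_cases)
    case (1 s)
    have "poly (conj_poly s x) x = 0"
      using 1 by (auto simp: conj_poly_def poly_prod intro!: bexI[of _ 0])
    then have "poly g x = 0" using 1 by (auto elim!: dvdE)
    then show ?case using 0 by (simp add: order_root)
  qed
  then show ?case using 0 by (metis card.empty)
next
  case (Suc m)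
  then have root: "poly g x = 0" by (simp add: order_root)
  define e where "e = (LEAST e. e > 0 \<and> x \<in> fixed_field e)"
  have e: "e > 0" "x \<in> fixed_field e"
    using LeastI_ex[OF root_periodic[OF Suc.prems root]] by (auto simp: e_def)
  have min: "e \<le> s" if "s > 0" "x \<in> fixed_field s" for s
    unfolding e_def using that by (intro Least_le) auto
  have inj: "inj_on (\<lambda>i. x ^ q ^ i) {..<e}"
  proof (rule linorder_inj_onI')
    fix i j assume ij: "i \<in> {..<e}" "j \<in> {..<e}" "i < j"
    show "x ^ q ^ i \<noteq> x ^ q ^ j"
    proof
      assume "x ^ q ^ i = x ^ q ^ j"
      then have "x ^ q ^ i = (x ^ q ^ (j - i)) ^ q ^ i"
        using ij by (simp flip: power_mult power_add)
      then have "x = x ^ q ^ (j - i)" by (rule frob_pow_inj)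
      then show False using min[of "j - i"] ij by (simp add: fixed_field_def)
    qed
  qed
  then have "conj_poly e x dvd g"
    unfolding conj_poly_def by (intro prod_linear_dvd root_frob Suc root) auto
  then obtain h where h: "g = conj_poly e x * h" by auto
  have h_fixed: "h \<in> fixed_polys" "h \<noteq> 0"
    using fixed_polys_cofactor[OF conj_poly_fixed[OF e(2)]] Suc.prems h by auto
  have "Polynomial.order x (conj_poly e x) = 1"
  proof -
    obtain e' where e': "e = Suc e'" using e by (cases e) auto
    have "conj_poly e x = [:- x, 1:] * (\<Prod>i<e'. [:- (x ^ q ^ Suc i), 1:])"
      unfolding conj_poly_def e' by (subst prod.lessThan_Suc_shift) simp
    moreover have "Polynomial.order x (\<Prod>i<e'. [:- (x ^ q ^ Suc i), 1:]) = 0"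
    proof (rule order_0I)
      have "x \<noteq> x ^ q ^ Suc i" if "i < e'" for i
        using inj_onD[OF inj, of "Suc i" 0] that by (auto simp: e')
      then show "poly (\<Prod>i<e'. [:- (x ^ q ^ Suc i), 1:]) x \<noteq> 0"
        by (auto simp: poly_prod simp del: power_Suc)
    qed
    moreover have "Polynomial.order x [:- x, 1:] = 1"
      using order_power_n_n[of x 1] by simp
    ultimately show ?thesis
      by (metis order_mult conj_poly_nonzero add.right_neutral)
  qed
  then have ord: "Polynomial.order x g = Suc (Polynomial.order x h)"
    using order_mult[of "conj_poly e x" h x] Suc.prems h by simp
  let ?S = "\<lambda>g. {s. 1 \<le> s \<and> x \<in> fixed_field s \<and> conj_poly s x dvd g}"
  have fin: "finite (?S h)"
  proof (rule finite_subset)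
    show "?S h \<subseteq> {..Polynomial.degree h}"
      using dvd_imp_degree_le[OF _ h_fixed(2)] degree_conj_poly by fastforce
  qed simp
  have iff: "conj_poly (e + s) x dvd g \<longleftrightarrow> conj_poly s x dvd h" for s
    by (simp add: h conj_poly_add[OF e(2)])
  have "?S g = insert e ((+) e ` ?S h)"
  proof (intro Set.set_eqI)
    fix s
    show "s \<in> ?S g \<longleftrightarrow> s \<in> insert e ((+) e ` ?S h)"
    proof (cases "s > e")
      case True
      then obtain t where t: "s = e + t" "t \<ge> 1"
        by (metis less_imp_add_positive less_eq_Suc_le One_nat_def)
      then show ?thesis using iff[of t] fixed_field_add_iff[OF e(2), of t] by auto
    next
      case False
      then show ?thesis using min[of s] e h by (auto simp: )
    qed
  qed
  moreover have "card (insert e ((+) e ` ?S h)) = Suc (card (?S h))"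
    using fin by (simp add: card_insert_if card_image image_iff)
  moreover have "Polynomial.order x h = card (?S h)"
    using Suc.hyps(2) ord by (intro Suc.hyps(1) h_fixed) simp
  ultimately show ?case using ord by simp
qed

lemma fixed_field_roots:
  assumes "s > 0"
  shows "finite (fixed_field s)" "card (fixed_field s) \<le> q ^ s"
proof -
  let ?p = "Polynomial.monom 1 (q ^ s) - Polynomial.monom 1 1 :: 'b poly"
  have lt: "1 < q ^ s" using q_gt_1 assms one_less_power by blast
  then have "Polynomial.coeff ?p (q ^ s) = 1" by simp
  then have nz: "?p \<noteq> 0" by (metis coeff_0 zero_neq_one)
  have eq: "fixed_field s = {x. poly ?p x = 0}"
    by (auto simp: fixed_field_def poly_monom)
  show "finite (fixed_field s)" unfolding eq using poly_roots_finite[OF nz] .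
  have "Polynomial.degree ?p \<le> q ^ s"
    using lt by (intro degree_diff_le) (auto simp: degree_monom_eq)
  then show "card (fixed_field s) \<le> q ^ s"
    unfolding eq using card_poly_roots_bound[OF nz] by simp
qed

lemma finite_monics: "finite (monics n)"
proof (rule finite_subset)
  show "monics n \<subseteq> Poly ` {xs. set xs \<subseteq> fixed_field 1 \<and> length xs \<le> Suc n}"
  proof
    fix g assume g: "g \<in> monics n"
    have "g = Poly (coeffs g)" by simp
    moreover have "set (coeffs g) \<subseteq> fixed_field 1"
      using g unfolding monics_def fixed_polys_def fixed_field_def
      by (auto simp: coeffs_def poly_eq_iff coeff_frob_poly)
    moreover have "length (coeffs g) \<le> Suc n"
      using g by (auto simp: monics_def length_coeffs_degree coeffs_def)
    ultimately show "g \<in> Poly ` {xs. set xs \<subseteq> fixed_field 1 \<and> length xs \<le> Suc n}" by blast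
  qed
  show "finite (Poly ` {xs. set xs \<subseteq> fixed_field 1 \<and> length xs \<le> Suc n})"
    using fixed_field_roots[of 1] by (intro finite_imageI finite_lists_length_le) auto
qed

text \<open>
  This is the logarithmic derivative of the Euler product of the L-function of \<open>\<chi>\<close>. It is obtained by
  writing the degree \<open>n\<close> of \<open>g\<close> as the number of pairs \<open>(s, x)\<close> such that \<open>conj_poly s x\<close> divides \<open>g\<close>, and
  by summing, for each pair, over the cofactor, which is monic of degree \<open>n - s\<close>.
\<close>

lemma newton_identity:
  fixes \<chi> :: "'b poly \<Rightarrow> 'c :: comm_ring_1"
  assumes mult: "\<And>f g. f \<in> fixed_polys \<Longrightarrow> g \<in> fixed_polys \<Longrightarrow> \<chi> (f * g) = \<chi> f * \<chi> g"
  shows "of_nat n * (\<Sum>g\<in>monics n. \<chi> g) =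
    (\<Sum>s=1..n. (\<Sum>x\<in>fixed_field s. \<chi> (conj_poly s x)) * (\<Sum>g\<in>monics (n - s). \<chi> g))"
proof -
  define U where "U = (\<Union>s\<in>{1..n}. fixed_field s)"
  define D where "D = (\<lambda>g x s. if x \<in> fixed_field s \<and> conj_poly s x dvd g then 1 else 0 :: nat)"
  have U: "finite U" unfolding U_def using fixed_field_roots by auto
  have deg: "n = (\<Sum>x\<in>U. \<Sum>s=1..n. D g x s)" if g: "g \<in> monics n" for g
  proof -
    have gf: "g \<in> fixed_polys" "g \<noteq> 0" "Polynomial.degree g = n"
      using g by (auto simp: monics_def)
    have ord: "Polynomial.order x g = (\<Sum>s=1..n. D g x s)" for x
    proof -
      have "{s. 1 \<le> s \<and> x \<in> fixed_field s \<and> conj_poly s x dvd g} =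
            {s \<in> {1..n}. x \<in> fixed_field s \<and> conj_poly s x dvd g}"
        using dvd_imp_degree_le[OF _ gf(2)] degree_conj_poly gf(3) by fastforce
      then show ?thesis unfolding order_eq_card[OF gf(1,2)] D_def
        by (simp add: sum.If_cases Int_def)
    qed
    have "poly g x = 0 \<Longrightarrow> x \<in> U" for x
    proof -
      assume "poly g x = 0"
      then have "(\<Sum>s=1..n. D g x s) \<noteq> 0" using ord[of x] gf by (simp add: order_root)
      then obtain s where "s \<in> {1..n}" "D g x s \<noteq> 0" by (meson sum.neutral)
      then show "x \<in> U" by (auto simp: U_def D_def split: if_splits)
    qed
    then have "(\<Sum>x\<in>U. Polynomial.order x g) = (\<Sum>x | poly g x = 0. Polynomial.order x g)"
      using U gf by (intro sum.mono_neutral_right) (auto simp: order_root)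
    then show ?thesis using degree_eq_sum_order[OF gf(2)] gf(3) ord by simp
  qed
  have inner: "(\<Sum>g\<in>monics n. of_nat (D g x s) * \<chi> g) =
      (if x \<in> fixed_field s then \<chi> (conj_poly s x) * (\<Sum>g\<in>monics (n - s). \<chi> g) else 0)"
    if s: "s \<in> {1..n}" for x s
  proof (cases "x \<in> fixed_field s")
    case True
    let ?C = "conj_poly s x"
    have "(\<Sum>g\<in>monics n. of_nat (D g x s) * \<chi> g) = (\<Sum>g | g \<in> monics n \<and> ?C dvd g. \<chi> g)"
      using finite_monics True by (intro sum.mono_neutral_cong_right) (auto simp: D_def)
    also have "{g. g \<in> monics n \<and> ?C dvd g} = (*) ?C ` monics (n - s)"
    proof (intro equalityI subsetI)
      fix g assume g: "g \<in> {g. g \<in> monics n \<and> ?C dvd g}"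
      then obtain h where h: "g = ?C * h" by auto
      have hf: "h \<in> fixed_polys" "h \<noteq> 0"
        using fixed_polys_cofactor[OF conj_poly_fixed[OF True]] g h by (auto simp: monics_def)
      have "Polynomial.degree g = s + Polynomial.degree h"
        using hf h by (simp add: degree_mult_eq)
      moreover have "lead_coeff g = lead_coeff h"
        unfolding h lead_coeff_mult by (simp add: lead_coeff_conj_poly)
      moreover have "Polynomial.degree g = n" "lead_coeff g = 1"
        using g by (auto simp: monics_def)
      ultimately have "h \<in> monics (n - s)"
        using hf by (auto simp: monics_def)
      then show "g \<in> (*) ?C ` monics (n - s)" using h by blast
    next
      fix g assume "g \<in> (*) ?C ` monics (n - s)"
      then obtain h where h: "g = ?C * h" "h \<in> monics (n - s)" by auto
      then have hz: "h \<noteq> 0" by (auto simp: monics_def)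
      have "Polynomial.degree g = n"
        using h hz s by (simp add: degree_mult_eq monics_def)
      moreover have "lead_coeff g = 1"
        using h unfolding h(1) lead_coeff_mult by (auto simp: lead_coeff_conj_poly monics_def)
      ultimately show "g \<in> {g. g \<in> monics n \<and> ?C dvd g}"
        using h conj_poly_fixed[OF True] fixed_polys_mult by (auto simp: monics_def)
    qed
    also have "(\<Sum>g\<in>(*) ?C ` monics (n - s). \<chi> g) = (\<Sum>h\<in>monics (n - s). \<chi> (?C * h))"
      by (subst sum.reindex) (auto simp: inj_on_def)
    also have "\<dots> = \<chi> ?C * (\<Sum>h\<in>monics (n - s). \<chi> h)"
      unfolding sum_distrib_left
      by (intro sum.cong refl mult conj_poly_fixed True) (auto simp: monics_def)
    finally show ?thesis using True by simp
  qed (simp add: D_def)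
  have "of_nat n * (\<Sum>g\<in>monics n. \<chi> g) = (\<Sum>g\<in>monics n. \<Sum>x\<in>U. \<Sum>s=1..n. of_nat (D g x s) * \<chi> g)"
    unfolding sum_distrib_left
  proof (intro sum.cong refl)
    fix g assume "g \<in> monics n"
    then have "of_nat n * \<chi> g = of_nat (\<Sum>x\<in>U. \<Sum>s=1..n. D g x s) * \<chi> g"
      using deg by simp
    then show "of_nat n * \<chi> g = (\<Sum>x\<in>U. \<Sum>s=1..n. of_nat (D g x s) * \<chi> g)"
      by (simp add: sum_distrib_right)
  qed
  also have "\<dots> = (\<Sum>x\<in>U. \<Sum>g\<in>monics n. \<Sum>s=1..n. of_nat (D g x s) * \<chi> g)"
    by (rule sum.swap)
  also have "\<dots> = (\<Sum>x\<in>U. \<Sum>s=1..n. \<Sum>g\<in>monics n. of_nat (D g x s) * \<chi> g)"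
    by (intro sum.cong refl sum.swap)
  also have "\<dots> = (\<Sum>s=1..n. \<Sum>x\<in>U. \<Sum>g\<in>monics n. of_nat (D g x s) * \<chi> g)"
    by (rule sum.swap)
  also have "\<dots> = (\<Sum>s=1..n. \<Sum>x\<in>U. if x \<in> fixed_field s
      then \<chi> (conj_poly s x) * (\<Sum>g\<in>monics (n - s). \<chi> g) else 0)"
    by (intro sum.cong refl inner)
  also have "\<dots> = (\<Sum>s=1..n. (\<Sum>x\<in>fixed_field s. \<chi> (conj_poly s x)) * (\<Sum>g\<in>monics (n - s). \<chi> g))"
  proof (intro sum.cong refl)
    fix s assume "s \<in> {1..n}"
    then have "fixed_field s \<subseteq> U" by (auto simp: U_def)
    then show "(\<Sum>x\<in>U. if x \<in> fixed_field s
      then \<chi> (conj_poly s x) * (\<Sum>g\<in>monics (n - s). \<chi> g) else 0) =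
      (\<Sum>x\<in>fixed_field s. \<chi> (conj_poly s x)) * (\<Sum>g\<in>monics (n - s). \<chi> g)"
      using U unfolding sum_distrib_right
      by (intro sum.mono_neutral_cong_right) auto
  qed
  finally show ?thesis .
qed

lemma interpolation_poly:
  assumes "finite P" "P \<subseteq> fixed_field 1" "p0 \<in> P"
  obtains L where "L \<in> fixed_polys" "poly L p0 = 1" "\<And>p. p \<in> P - {p0} \<Longrightarrow> poly L p = 0"
    "Polynomial.degree L < card P"
proof
  let ?N = "\<Prod>p\<in>P - {p0}. [:- p, 1:]"
  let ?c = "\<Prod>p\<in>P - {p0}. p0 - p"
  let ?L = "smult (inverse ?c) ?N"
  have c: "?c \<noteq> 0" using assms by auto
  have fixed: "p ^ q = p" if "p \<in> P" for p using that assms by (auto simp: fixed_field_def)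
  have "frob_poly ?N = ?N"
    unfolding frob_poly_prod using assms
    by (intro prod.cong refl) (auto simp: frob_poly_linear fixed)
  moreover have "?c ^ q = ?c"
    unfolding prod_power_distrib using assms
    by (intro prod.cong refl) (auto simp: frob_diff fixed)
  ultimately show "?L \<in> fixed_polys"
    by (simp add: fixed_polys_def frob_poly_def map_poly_smult zero_power power_mult_distrib power_inverse)
  show "poly ?L p0 = 1" using c by (simp add: poly_prod)
  show "poly ?L p = 0" if "p \<in> P - {p0}" for p
    using that assms by (auto simp: poly_prod)
  have "Polynomial.degree ?L = card (P - {p0})"
    using c by (simp add: degree_prod_eq_sum_degree)
  then show "Polynomial.degree ?L < card P"
    using assms by (metis card_Diff1_less)
qed

text \<open>
  Since \<open>n\<close> is at least the number of points, adding a multiple of a Lagrange polynomial keeps \<open>g\<close>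
  monic of degree \<open>n\<close>. So \<open>g p0\<close> can be multiplied by \<open>u\<close> with all other values \<open>g p\<close> unchanged. This is a
  permutation of the monic polynomials of degree \<open>n\<close> that multiplies the summand by \<open>\<chi> p0 u \<noteq> 1\<close>.
\<close>

lemma monic_sum_eq_0:
  fixes \<chi> :: "'b \<Rightarrow> 'b \<Rightarrow> 'c :: idom"
  assumes P: "finite P" "P \<subseteq> fixed_field 1" "card P \<le> n"
    and p0: "p0 \<in> P" and u: "u \<in> fixed_field 1" "u \<noteq> 0" "\<chi> p0 u \<noteq> 1"
    and mult: "\<And>x. x \<in> fixed_field 1 \<Longrightarrow> \<chi> p0 (u * x) = \<chi> p0 u * \<chi> p0 x"
  shows "(\<Sum>g\<in>monics n. \<Prod>p\<in>P. \<chi> p (poly g p)) = 0"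
proof -
  obtain L where L: "L \<in> fixed_polys" "poly L p0 = 1" "\<And>p. p \<in> P - {p0} \<Longrightarrow> poly L p = 0"
    "Polynomial.degree L < card P"
    using interpolation_poly[OF P(1,2) p0] by blast
  define T where "T = (\<lambda>v g. g + smult ((v - 1) * poly g p0) L)"
  have p0f: "p0 \<in> fixed_field 1" using P p0 by auto
  have T_p0: "poly (T v g) p0 = v * poly g p0" for v g
    using L by (simp add: T_def algebra_simps)
  have T_p: "poly (T v g) p = poly g p" if "p \<in> P - {p0}" for v g p
    using L that by (simp add: T_def)
  have T_mem: "T v g \<in> monics n" if "g \<in> monics n" "v \<in> fixed_field 1" for v g
  proof -
    have g: "g \<in> fixed_polys" "Polynomial.degree g = n" "Polynomial.coeff g n = 1"
      using that by (auto simp: monics_def)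
    have lt: "Polynomial.degree (smult ((v - 1) * poly g p0) L) < n"
      using L P by (meson degree_smult_le le_less_trans less_le_trans)
    have "((v - 1) * poly g p0) ^ q = (v - 1) * poly g p0"
      using that poly_fixed[OF g(1) p0f] by (simp add: power_mult_distrib frob_diff fixed_field_def)
    then have "frob_poly (smult ((v - 1) * poly g p0) L) = smult ((v - 1) * poly g p0) L"
      using L(1) unfolding fixed_polys_def frob_poly_def
      by (subst map_poly_smult) (auto simp: zero_power power_mult_distrib)
    then have "T v g \<in> fixed_polys"
      using g by (simp add: T_def fixed_polys_def frob_poly_add)
    moreover have "Polynomial.degree (T v g) = n"
      unfolding T_def using lt g by (subst degree_add_eq_left) auto
    moreover have "Polynomial.coeff (T v g) n = 1"
      unfolding T_def using g coeff_eq_0[OF lt] by simp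
    ultimately show ?thesis by (simp add: monics_def)
  qed
  have T_T: "T v (T w g) = g" if "v * w = 1" for v w g
  proof -
    have "(w - 1) * poly g p0 + (v - 1) * poly (T w g) p0 = 0"
      unfolding T_p0 using that by (simp add: algebra_simps flip: mult.assoc)
    then show ?thesis
      unfolding T_def by (metis T_def add.assoc add.right_neutral smult_0_left smult_add_left)
  qed
  have u': "inverse u \<in> fixed_field 1" using u by (simp add: fixed_field_def power_inverse)
  let ?X = "\<lambda>g. \<Prod>p\<in>P. \<chi> p (poly g p)"
  have X_T: "?X (T u g) = \<chi> p0 u * ?X g" if "g \<in> monics n" for g
  proof -
    have "?X (T u g) = \<chi> p0 (u * poly g p0) * (\<Prod>p\<in>P - {p0}. \<chi> p (poly g p))"
      using P p0 T_p by (subst prod.remove[of _ p0]) (auto simp: T_p0)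
    also have "\<chi> p0 (u * poly g p0) = \<chi> p0 u * \<chi> p0 (poly g p0)"
      using that by (intro mult poly_fixed p0f) (auto simp: monics_def)
    finally show ?thesis using P p0 by (simp add: prod.remove[of _ p0] mult.assoc)
  qed
  have "(\<Sum>g\<in>monics n. ?X g) = (\<Sum>g\<in>monics n. ?X (T u g))"
    by (rule sum.reindex_bij_witness[of _ "T u" "T (inverse u)"])
      (use T_T T_mem u u' in auto)
  also have "\<dots> = \<chi> p0 u * (\<Sum>g\<in>monics n. ?X g)"
    unfolding sum_distrib_left by (intro sum.cong refl X_T)
  finally have "(1 - \<chi> p0 u) * (\<Sum>g\<in>monics n. ?X g) = 0" by (simp add: algebra_simps)
  then show ?thesis using u by simp
qed

end

section \<open>Finite subfields and their multiplicative characters\<close>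

locale finite_subfield =
  fixes Q :: nat and K :: "'a::field set"
  assumes finite_field: "finite_field Q K"
begin

lemma finite_K [simp]: "finite K" and card_K: "card K = Q"
  using finite_field by (auto simp: finite_field_def)

lemma subfield_K: "subfield K (ring_of_type_algebra :: 'a ring)"
  using finite_field by (simp add: finite_field_def)

lemma subring_K: "subring K (ring_of_type_algebra :: 'a ring)"
  using subfield_K by (simp add: subfield_def subdomain_def subcring_def)

lemma one_closed [simp]: "1 \<in> K" and zero_closed [simp]: "0 \<in> K"
  using subringE(2,3)[OF subring_K] by (auto simp: ring_of_type_algebra_def)

lemma add_closed: "x \<in> K \<Longrightarrow> y \<in> K \<Longrightarrow> x + y \<in> K"
  and mult_closed: "x \<in> K \<Longrightarrow> y \<in> K \<Longrightarrow> x * y \<in> K"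
  using subringE(6,7)[OF subring_K, of x y] by (auto simp: ring_of_type_algebra_def)

lemma minus_closed: "x \<in> K \<Longrightarrow> - x \<in> K"
proof -
  assume x: "x \<in> K"
  interpret R: Ring.ring "ring_of_type_algebra :: 'a ring"
    using ring_from_type_algebra .
  have "- x = \<ominus>\<^bsub>ring_of_type_algebra\<^esub> x"
    by (rule sym, rule R.minus_equality) (auto simp: ring_of_type_algebra_def)
  then show ?thesis using subringE(5)[OF subring_K x] by simp
qed

lemma diff_closed: "x \<in> K \<Longrightarrow> y \<in> K \<Longrightarrow> x - y \<in> K"
  using add_closed[of x "- y"] minus_closed[of y] by simp

lemma pow_closed: "x \<in> K \<Longrightarrow> x ^ n \<in> K"
  by (induction n) (auto intro: mult_closed)

lemma units_mult_bij:
  assumes "x \<in> K - {0}"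
  shows "bij_betw ((*) x) (K - {0}) (K - {0})"
proof -
  have inj: "inj_on ((*) x) (K - {0})" using assms by (auto simp: inj_on_def)
  moreover have "(*) x ` (K - {0}) \<subseteq> K - {0}" using assms by (auto intro: mult_closed)
  ultimately show ?thesis by (simp add: bij_betw_def endo_inj_surj)
qed

lemma units_pow_eq_1:
  assumes "x \<in> K - {0}"
  shows "x ^ (Q - 1) = 1"
proof -
  have "(\<Prod>y\<in>K - {0}. y) = (\<Prod>y\<in>K - {0}. x * y)"
    using prod.reindex_bij_betw[OF units_mult_bij[OF assms], of "\<lambda>y. y"] by simp
  also have "\<dots> = x ^ (Q - 1) * (\<Prod>y\<in>K - {0}. y)"
    by (simp add: prod.distrib card_K)
  finally show ?thesis by simp
qed

lemma Q_gt_1: "Q > 1"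
proof -
  have "card {0, 1 :: 'a} \<le> card K" by (intro card_mono) auto
  then show ?thesis by (simp add: card_K)
qed

lemma pow_Q: "x \<in> K \<Longrightarrow> x ^ Q = x"
proof (cases "x = 0")
  case False
  assume "x \<in> K"
  then have "x ^ Suc (Q - 1) = x" using units_pow_eq_1[of x] False by simp
  then show ?thesis using Q_gt_1 by simp
qed (use Q_gt_1 in \<open>auto simp: zero_power\<close>)

lemma inverse_closed: "x \<in> K \<Longrightarrow> inverse x \<in> K"
proof (cases "x = 0")
  case False
  assume x: "x \<in> K"
  obtain y where "y \<in> K - {0}" "x * y = 1"
    using units_mult_bij[of x] x False unfolding bij_betw_def
    by (metis DiffI imageE one_closed singletonD zero_neq_one)
  then show ?thesis using inverse_unique by fastforce
qed auto

lemma divide_closed: "x \<in> K \<Longrightarrow> y \<in> K \<Longrightarrow> x / y \<in> K"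
  by (simp add: divide_inverse mult_closed inverse_closed)

lemma of_nat_Q: "of_nat Q = (0 :: 'a)"
proof -
  have "bij_betw ((+) 1) K K"
    by (rule bij_betw_byWitness[of _ "\<lambda>x. x - 1"]) (auto intro: add_closed diff_closed)
  then have "(\<Sum>y\<in>K. y) = (\<Sum>y\<in>K. 1 + y)"
    using sum.reindex_bij_betw[of "(+) 1" K K "\<lambda>y. y"] by simp
  also have "\<dots> = of_nat Q + (\<Sum>y\<in>K. y)"
    by (simp add: sum.distrib card_K)
  finally show ?thesis by simp
qed

lemma char_mult: "\<eta> \<in> mult_chars K \<Longrightarrow> x \<in> K \<Longrightarrow> y \<in> K \<Longrightarrow> \<eta> (x * y) = \<eta> x * \<eta> y"
  by (cases "x = 0"; cases "y = 0") (auto simp: mult_chars_def)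

lemma char_eq_0_iff: "\<eta> \<in> mult_chars K \<Longrightarrow> \<eta> x = 0 \<longleftrightarrow> x \<notin> K - {0}"
  by (auto simp: mult_chars_def)

lemma char_0 [simp]: "\<eta> \<in> mult_chars K \<Longrightarrow> \<eta> 0 = 0"
  by (simp add: char_eq_0_iff)

lemma char_1 [simp]: "\<eta> \<in> mult_chars K \<Longrightarrow> \<eta> 1 = 1"
  using char_mult[of \<eta> 1 1] char_eq_0_iff[of \<eta> 1] by auto

lemma char_inverse: "\<eta> \<in> mult_chars K \<Longrightarrow> x \<in> K \<Longrightarrow> \<eta> (inverse x) = inverse (\<eta> x)"
proof (cases "x = 0")
  case False
  assume "\<eta> \<in> mult_chars K" "x \<in> K"
  then have "\<eta> x * \<eta> (inverse x) = 1"
    using char_mult[of \<eta> x "inverse x"] inverse_closed[of x] False by simp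
  then show ?thesis by (rule inverse_unique[symmetric])
qed auto

lemma char_divide: "\<eta> \<in> mult_chars K \<Longrightarrow> x \<in> K \<Longrightarrow> y \<in> K \<Longrightarrow> \<eta> (x / y) = \<eta> x / \<eta> y"
  by (simp add: divide_inverse char_mult char_inverse inverse_closed)

lemma char_power: "\<eta> \<in> mult_chars K \<Longrightarrow> x \<in> K \<Longrightarrow> \<eta> (x ^ n) = \<eta> x ^ n"
  by (induction n) (auto simp: char_mult pow_closed)

lemma char_mult_closed:
  "\<alpha> \<in> mult_chars K \<Longrightarrow> \<beta> \<in> mult_chars K \<Longrightarrow> (\<lambda>x. \<alpha> x * \<beta> x) \<in> mult_chars K"
  by (auto simp: mult_chars_def)

lemma char_inverse_closed: "\<alpha> \<in> mult_chars K \<Longrightarrow> (\<lambda>x. inverse (\<alpha> x)) \<in> mult_chars K"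
  by (auto simp: mult_chars_def)

lemma triv_char_closed: "triv_char K \<in> mult_chars K"
  by (auto simp: mult_chars_def triv_char_def intro: mult_closed)

lemmas chars_closed = char_mult_closed char_inverse_closed triv_char_closed

lemma nontriv_char:
  assumes "\<eta> \<in> mult_chars K" "\<eta> \<noteq> triv_char K"
  obtains u where "u \<in> K - {0}" "\<eta> u \<noteq> 1"
proof -
  have "\<exists>u\<in>K - {0}. \<eta> u \<noteq> 1"
  proof (rule ccontr)
    assume "\<not> ?thesis"
    then have "\<eta> x = triv_char K x" for x
      using assms(1) char_eq_0_iff[OF assms(1), of x] by (auto simp: triv_char_def)
    then show False using assms(2) by (simp add: fun_eq_iff)
  qed
  then show thesis using that by blast
qed

text \<open>
  The field \<open>'c\<close> stands for the given one and for its algebraic closure. The order \<open>Q\<close> is a power of the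
  characteristic because it is a prime power that vanishes in the field.
\<close>

lemma frobenius_additive:
  assumes "primepow Q" "CHAR('c :: field) = CHAR('a)"
  shows "(x + y :: 'c) ^ Q = x ^ Q + y ^ Q"
proof -
  have dvd: "CHAR('a) dvd Q" using of_nat_Q by (simp add: of_nat_eq_0_iff_char_dvd)
  then have "CHAR('a) > 0" using Q_gt_1 by (intro Nat.gr0I) auto
  then have pr: "Factorial_Ring.prime CHAR('a)" by (intro prime_CHAR_semidom)
  obtain p e where pe: "Factorial_Ring.prime p" "Q = p ^ e" using assms(1) by (auto simp: primepow_def)
  then have "CHAR('a) = p"
    using dvd pr by (metis prime_dvd_power primes_dvd_imp_eq)
  then show ?thesis using pr pe assms(2) by (intro freshmans_dream'[of Q e]) auto
qed

end

section \<open>Character sums over extensions as power sums\<close>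

lemma ff_norm_mult: "ff_norm q s (x * y) = ff_norm q s x * ff_norm q s y"
  by (simp add: ff_norm_def power_mult_distrib prod.distrib)

locale base_field = finite_subfield q k for q :: nat and k :: "'a::field set" +
  assumes primepow_q: "primepow q"
begin

sublocale ac: frobenius_field q "TYPE('a alg_closure)"
  using Q_gt_1 by unfold_locales (auto intro!: frobenius_additive primepow_q)

text \<open>
  The right side contains the left side and has at most \<open>q ^ s\<close> elements, because it consists of the
  solutions of a polynomial equation of that degree. So every
  extension of degree \<open>s\<close> inside the given type can be replaced by the one in the algebraic closure.
\<close>

lemma to_ac_image_subfield:
  assumes "finite_field (q ^ s) l" "s > 0"
  shows "to_ac ` l = ac.fixed_field s"
proof (rule card_seteq)
  interpret l: finite_subfield "q ^ s" l using assms by unfold_locales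
  show "finite (ac.fixed_field s)" using ac.fixed_field_roots assms by blast
  show "to_ac ` l \<subseteq> ac.fixed_field s"
    by (auto simp: ac.fixed_field_def l.pow_Q simp flip: to_ac_power)
  show "card (ac.fixed_field s) \<le> card (to_ac ` l)"
    using ac.fixed_field_roots assms by (simp add: card_image inj_on_def l.card_K)
qed

lemma to_ac_image_base: "to_ac ` k = ac.fixed_field 1"
  using to_ac_image_subfield[of 1 k] finite_field by simp

lemma mem_base_iff: "x \<in> k \<longleftrightarrow> x ^ q = x"
proof -
  have "x ^ q = x \<longleftrightarrow> to_ac x \<in> ac.fixed_field 1"
    by (simp add: ac.fixed_field_def flip: to_ac_power)
  also have "\<dots> \<longleftrightarrow> x \<in> k"
    unfolding to_ac_image_base[symmetric] by auto
  finally show ?thesis by simp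
qed

lemma ff_norm_base:
  assumes "x \<in> k"
  shows "ff_norm q s x = x ^ s"
proof -
  have "x ^ q ^ i = x" for i
    by (induction i) (use assms mem_base_iff in \<open>auto simp: power_mult\<close>)
  then show ?thesis by (simp add: ff_norm_def)
qed

lemma ff_norm_in_base:
  assumes "finite_field (q ^ s) l" "x \<in> l"
  shows "ff_norm q s x \<in> k"
proof (cases s)
  case (Suc m)
  interpret l: finite_subfield "q ^ s" l using assms by unfold_locales
  have "ff_norm q s x ^ q = (\<Prod>i<Suc m. x ^ q ^ Suc i)"
    unfolding ff_norm_def Suc prod_power_distrib
    by (simp only: power_Suc mult.commute[of q] power_mult)
  also have "\<dots> = (\<Prod>i<m. x ^ q ^ Suc i) * x ^ q ^ 0"
    using l.pow_Q[OF assms(2)] Suc by simp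
  also have "\<dots> = ff_norm q s x"
    unfolding ff_norm_def Suc prod.lessThan_Suc_shift by (simp only: mult.commute)
  finally show ?thesis by (simp add: mem_base_iff)
qed (simp add: ff_norm_def)

lemma ff_norm_eq_0_iff: "s > 0 \<Longrightarrow> ff_norm q s x = 0 \<longleftrightarrow> (x :: 'a) = 0"
  using ac.q_pos by (auto simp: ff_norm_def)

lemma lift_char_mult_chars:
  assumes "finite_field (q ^ s) l" "s > 0" "\<eta> \<in> mult_chars k"
  shows "lift_char q s l \<eta> \<in> mult_chars l"
proof -
  interpret l: finite_subfield "q ^ s" l using assms by unfold_locales
  show ?thesis
    using assms ff_norm_in_base[OF assms(1)] ff_norm_eq_0_iff[OF assms(2)]
    unfolding mult_chars_def[of l] lift_char_def
    by (auto simp: ff_norm_mult char_mult l.mult_closed char_eq_0_iff)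
qed

lemma of_ac_fixed: "y \<in> ac.fixed_field 1 \<Longrightarrow> of_ac y \<in> k \<and> to_ac (of_ac y) = y"
  unfolding to_ac_image_base[symmetric] by auto

lemma char_of_ac_mult:
  assumes "\<eta> \<in> mult_chars k" "x \<in> ac.fixed_field 1" "y \<in> ac.fixed_field 1"
  shows "\<eta> (of_ac (x * y)) = \<eta> (of_ac x) * \<eta> (of_ac y)"
proof -
  have "of_ac (x * y) = of_ac x * of_ac y"
    using assms(2,3) of_ac_fixed by (intro of_ac_eqI) simp
  then show ?thesis using assms of_ac_fixed by (simp add: char_mult)
qed

text \<open>
  The sequence \<open>S\<close> is a single one for all extensions. It is defined in the algebraic closure, because for most
  \<open>s\<close> the field \<open>\<F>(q ^ s)\<close> need not occur inside the given type, while the recursion needs all \<open>S s\<close>.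
\<close>

lemma char_sums_newton:
  assumes P: "finite P" "P \<subseteq> k" and \<eta>: "\<And>p. p \<in> P \<Longrightarrow> \<eta> p \<in> mult_chars k"
    and p0: "p0 \<in> P" "\<eta> p0 \<noteq> triv_char k"
  obtains A S :: "nat \<Rightarrow> qbar" where
    "A 0 = 1" "\<And>n. n \<ge> card P \<Longrightarrow> A n = 0"
    "\<And>n. of_nat n * A n = (\<Sum>s=1..n. S s * A (n - s))"
    "\<And>s l. s > 0 \<Longrightarrow> finite_field (q ^ s) l \<Longrightarrow> k \<subseteq> l \<Longrightarrow>
       S s = (\<Sum>x\<in>l. \<Prod>p\<in>P. lift_char q s l (\<eta> p) (p - x))"
proof
  let ?\<chi> = "\<lambda>f. \<Prod>p\<in>P. \<eta> p (of_ac (poly f (to_ac p)))"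
  let ?A = "\<lambda>n. \<Sum>g\<in>ac.monics n. ?\<chi> g"
  let ?S = "\<lambda>s. \<Sum>x\<in>ac.fixed_field s. ?\<chi> (ac.conj_poly s x)"
  have P_fixed: "to_ac p \<in> ac.fixed_field 1" if "p \<in> P" for p
    using that P to_ac_image_base by blast
  have "ac.monics 0 = {1}"
    by (auto simp: ac.monics_def ac.fixed_polys_def ac.frob_poly_1 elim!: degree_eq_zeroE)
  moreover have "of_ac (1 :: 'a alg_closure) = 1" by (intro of_ac_eqI) simp
  ultimately show "?A 0 = 1" using \<eta> by simp
  show "of_nat n * ?A n = (\<Sum>s=1..n. ?S s * ?A (n - s))" for n
  proof (rule ac.newton_identity)
    fix f g assume "f \<in> ac.fixed_polys" "g \<in> ac.fixed_polys"
    then show "?\<chi> (f * g) = ?\<chi> f * ?\<chi> g"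
      unfolding prod.distrib[symmetric]
      by (intro prod.cong refl) (auto intro!: char_of_ac_mult \<eta> ac.poly_fixed P_fixed)
  qed
  show "?A n = 0" if n: "n \<ge> card P" for n
  proof -
    obtain u where u: "u \<in> k - {0}" "\<eta> p0 u \<noteq> 1"
      using nontriv_char[OF \<eta>[OF p0(1)] p0(2)] by blast
    have "?A n = (\<Sum>g\<in>ac.monics n. \<Prod>p\<in>to_ac ` P. \<eta> (of_ac p) (of_ac (poly g p)))"
      by (simp add: prod.reindex inj_on_def)
    also have "\<dots> = 0"
    proof (rule ac.monic_sum_eq_0)
      show "finite (to_ac ` P)" "to_ac ` P \<subseteq> ac.fixed_field 1" "to_ac p0 \<in> to_ac ` P"
        using P P_fixed p0 by auto
      show "card (to_ac ` P) \<le> n" using n by (simp add: card_image inj_on_def)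
      show u1: "to_ac u \<in> ac.fixed_field 1" using u to_ac_image_base by blast
      show "to_ac u \<noteq> 0" "\<eta> (of_ac (to_ac p0)) (of_ac (to_ac u)) \<noteq> 1" using u by auto
      show "\<eta> (of_ac (to_ac p0)) (of_ac (to_ac u * x)) =
          \<eta> (of_ac (to_ac p0)) (of_ac (to_ac u)) * \<eta> (of_ac (to_ac p0)) (of_ac x)"
        if "x \<in> ac.fixed_field 1" for x
        using that u1 \<eta>[OF p0(1)] by (intro char_of_ac_mult) auto
    qed
    finally show ?thesis .
  qed
  show "?S s = (\<Sum>x\<in>l. \<Prod>p\<in>P. lift_char q s l (\<eta> p) (p - x))"
    if s: "s > 0" and l: "finite_field (q ^ s) l" "k \<subseteq> l" for s l
  proof -
    interpret l: finite_subfield "q ^ s" l using l by unfold_locales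
    have eval: "poly (ac.conj_poly s (to_ac x)) (to_ac p) = to_ac (ff_norm q s (p - x))"
      if "p \<in> P" for p x
    proof -
      have "p ^ q ^ i = p" for i
        using that P mem_base_iff[of p] by (induction i) (auto simp: power_mult)
      then have "to_ac p ^ q ^ i = to_ac p" for i by (metis to_ac_power)
      moreover have "(y - z) ^ q ^ i = y ^ q ^ i - z ^ q ^ i" for y z :: "'a alg_closure" and i
        by (induction i) (simp_all add: ac.frob_diff power_mult mult.commute[of q])
      ultimately show ?thesis
        unfolding ac.conj_poly_def ff_norm_def poly_prod to_ac_prod to_ac_power to_ac_diff
        by (intro prod.cong refl) simp
    qed
    have "?S s = (\<Sum>x\<in>l. ?\<chi> (ac.conj_poly s (to_ac x)))"
      by (simp add: sum.reindex inj_on_def flip: to_ac_image_subfield[OF l(1) s])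
    also have "\<dots> = (\<Sum>x\<in>l. \<Prod>p\<in>P. lift_char q s l (\<eta> p) (p - x))"
      using P l by (intro sum.cong prod.cong refl) (auto simp: eval lift_char_def intro: l.diff_closed)
    finally show ?thesis .
  qed
qed

end

text \<open>
  Newton's identities for the polynomial \<open>1 + A 1 * T + A 2 * T ^ 2 = (1 - \<alpha> * T) * (1 - \<beta> * T)\<close>: from
  \<open>n = 3\<close> on they become the linear recursion that is also satisfied by \<open>\<alpha> ^ n + \<beta> ^ n\<close>.
\<close>

lemma newton_two_roots:
  fixes A S :: "nat \<Rightarrow> 'c :: field_char_0"
  assumes A: "A 0 = 1" "\<And>n. n \<ge> 3 \<Longrightarrow> A n = 0" "A 1 = - (\<alpha> + \<beta>)" "A 2 = \<alpha> * \<beta>"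
    and newton: "\<And>n. of_nat n * A n = (\<Sum>s=1..n. S s * A (n - s))"
  shows "n \<ge> 1 \<Longrightarrow> S n = - (\<alpha> ^ n + \<beta> ^ n)"
proof (induction n rule: less_induct)
  case (less n)
  have S1: "S 1 = - (\<alpha> + \<beta>)" using newton[of 1] A by simp
  consider "n = 1" | "n = 2" | m where "n = Suc (Suc (Suc m))"
    using less.prems by (metis One_nat_def Suc_1 not0_implies_Suc not_one_le_zero)
  then show ?case
  proof cases
    case 1
    then show ?thesis using S1 by simp
  next
    case 2
    have "{1..2::nat} = {1, 2}" by auto
    then have "2 * A 2 = S 1 * A 1 + S 2" using newton[of 2] A(1) by simp
    then have "S 2 = 2 * A 2 - S 1 * A 1" by (simp add: eq_diff_eq add.commute)
    also have "\<dots> = 2 * (\<alpha> * \<beta>) - (\<alpha> + \<beta>) * (\<alpha> + \<beta>)"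
      unfolding S1 A(3,4) minus_mult_minus ..
    finally have "S 2 = 2 * (\<alpha> * \<beta>) - (\<alpha> + \<beta>) * (\<alpha> + \<beta>)" .
    then show ?thesis unfolding 2 by (simp add: algebra_simps power2_eq_square)
  next
    case 3
    have "0 = (\<Sum>s=1..n. S s * A (n - s))" using newton[of n] A(2)[of n] 3 by simp
    also have "{1..n} = {1..m} \<union> {Suc m, Suc (Suc m), n}" using 3 by auto
    also have "(\<Sum>s\<in>{1..m} \<union> {Suc m, Suc (Suc m), n}. S s * A (n - s)) =
        (\<Sum>s=1..m. S s * A (n - s)) + (\<Sum>s\<in>{Suc m, Suc (Suc m), n}. S s * A (n - s))"
      using 3 by (intro sum.union_disjoint) auto
    also have "(\<Sum>s=1..m. S s * A (n - s)) = 0"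
      using 3 by (intro sum.neutral) (auto simp: A(2))
    also have "(\<Sum>s\<in>{Suc m, Suc (Suc m), n}. S s * A (n - s)) =
        S (Suc m) * A 2 + S (Suc (Suc m)) * A 1 + S n"
      using 3 A(1) by (simp add: Suc_diff_le numeral_2_eq_2)
    finally have "S n + (S (Suc m) * A 2 + S (Suc (Suc m)) * A 1) = 0"
      by (simp add: add_ac)
    then have "S n = - (S (Suc m) * A 2 + S (Suc (Suc m)) * A 1)"
      by (simp only: eq_neg_iff_add_eq_0)
    also have "S (Suc m) = - (\<alpha> ^ Suc m + \<beta> ^ Suc m)" using less.IH[of "Suc m"] 3 by simp
    also have "S (Suc (Suc m)) = - (\<alpha> ^ Suc (Suc m) + \<beta> ^ Suc (Suc m))"
      using less.IH[of "Suc (Suc m)"] 3 by simp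
    finally show ?thesis unfolding 3 A by (simp add: algebra_simps)
  qed
qed

context base_field
begin

text \<open>
  The numbers \<open>\<alpha>\<close> and \<open>\<beta>\<close> are the reciprocal roots of the L-function, whose degree is less than the number
  of points; a missing root counts as \<open>0\<close>.
\<close>

lemma char_sums_power_sums:
  assumes P: "finite P" "P \<subseteq> k" "card P \<le> 3" and \<eta>: "\<And>p. p \<in> P \<Longrightarrow> \<eta> p \<in> mult_chars k"
    and p0: "p0 \<in> P" "\<eta> p0 \<noteq> triv_char k"
  obtains \<alpha> \<beta> :: qbar where
    "\<And>s l. s > 0 \<Longrightarrow> finite_field (q ^ s) l \<Longrightarrow> k \<subseteq> l \<Longrightarrow>
       (\<Sum>x\<in>l. \<Prod>p\<in>P. lift_char q s l (\<eta> p) (p - x)) = - (\<alpha> ^ s + \<beta> ^ s)"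
    "card P \<le> 2 \<Longrightarrow> \<beta> = 0" "card P \<le> 1 \<Longrightarrow> \<alpha> = 0"
proof (rule char_sums_newton[of P \<eta> p0, OF P(1,2) \<eta> p0])
  fix A S :: "nat \<Rightarrow> qbar"
  assume AS: "A 0 = 1" "\<And>n. n \<ge> card P \<Longrightarrow> A n = 0"
    "\<And>n. of_nat n * A n = (\<Sum>s=1..n. S s * A (n - s))"
    "\<And>s l. s > 0 \<Longrightarrow> finite_field (q ^ s) l \<Longrightarrow> k \<subseteq> l \<Longrightarrow>
       S s = (\<Sum>x\<in>l. \<Prod>p\<in>P. lift_char q s l (\<eta> p) (p - x))"
  have "\<exists>\<alpha> \<beta>. A 1 = - (\<alpha> + \<beta>) \<and> A 2 = \<alpha> * \<beta> \<and>
      (card P \<le> 2 \<longrightarrow> \<beta> = 0) \<and> (card P \<le> 1 \<longrightarrow> \<alpha> = 0)"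
  proof (cases "card P \<le> 2")
    case True
    then show ?thesis using AS(2)[of 1] AS(2)[of 2] by (intro exI[of _ "- A 1"] exI[of _ 0]) auto
  next
    case False
    obtain \<alpha> where "poly [:A 2, A 1, 1:] \<alpha> = 0"
      using alg_closed_imp_poly_has_root[of "[:A 2, A 1, 1:]"] by auto
    then have "A 2 = \<alpha> * (- A 1 - \<alpha>)" by (simp add: algebra_simps eq_neg_iff_add_eq_0)
    then show ?thesis using False by (intro exI[of _ \<alpha>] exI[of _ "- A 1 - \<alpha>"]) auto
  qed
  then obtain \<alpha> \<beta> where ab: "A 1 = - (\<alpha> + \<beta>)" "A 2 = \<alpha> * \<beta>"
      "card P \<le> 2 \<Longrightarrow> \<beta> = 0" "card P \<le> 1 \<Longrightarrow> \<alpha> = 0"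
    by blast
  have "S s = - (\<alpha> ^ s + \<beta> ^ s)" if "s > 0" for s
    using that P by (intro newton_two_roots[OF _ _ ab(1,2) AS(3)]) (auto simp: AS(1,2))
  then show thesis using ab AS(4) by (intro that[of \<alpha> \<beta>]) auto
qed

text \<open>
  With the single point \<open>0\<close> the L-function is constant, so the values of the lifted character sum to \<open>0\<close>,
  whereas the values of the trivial character sum to \<open>q ^ s - 1\<close>. This argument takes the place of the
  surjectivity of the norm.
\<close>

lemma lift_char_nontriv:
  assumes l: "finite_field (q ^ s) l" "s > 0" "k \<subseteq> l"
    and \<eta>: "\<eta> \<in> mult_chars k" "\<eta> \<noteq> triv_char k"
  shows "lift_char q s l \<eta> \<noteq> triv_char l"
proof
  interpret l: finite_subfield "q ^ s" l using l by unfold_locales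
  assume triv: "lift_char q s l \<eta> = triv_char l"
  obtain \<alpha> \<beta> :: qbar where ab:
    "\<And>s l. s > 0 \<Longrightarrow> finite_field (q ^ s) l \<Longrightarrow> k \<subseteq> l \<Longrightarrow>
       (\<Sum>x\<in>l. \<Prod>p\<in>{0}. lift_char q s l \<eta> (p - x)) = - (\<alpha> ^ s + \<beta> ^ s)"
    "\<beta> = 0" "\<alpha> = 0"
    using char_sums_power_sums[of "{0}" "\<lambda>_. \<eta>" 0] \<eta> by auto
  have "(\<Sum>x\<in>l. triv_char l (- x)) = (0 :: qbar)"
    using ab(1)[OF l(2,1,3)] ab(2,3) l(2) triv by (simp add: zero_power)
  also have "(\<Sum>x\<in>l. triv_char l (- x)) = (\<Sum>x\<in>l - {0}. 1 :: qbar)"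
    by (intro sum.mono_neutral_cong_right) (auto simp: triv_char_def l.minus_closed)
  also have "\<dots> = of_nat (q ^ s - 1)" by (simp add: l.card_K)
  finally show False using l.Q_gt_1 by (metis of_nat_eq_0_iff diff_is_0_eq not_less)
qed

end

section \<open>Orthogonality of characters\<close>

text \<open>
  In characteristic zero the polynomial \<open>X ^ n - 1\<close> has no root in common with its derivative, so all its
  roots are simple.
\<close>

lemma card_roots_of_unity:
  assumes "n > 0"
  shows "finite {z :: 'c :: {alg_closed_field, field_char_0}. z ^ n = 1}"
    and "card {z :: 'c. z ^ n = 1} = n"
proof -
  let ?p = "Polynomial.monom 1 n - 1 :: 'c poly"
  have deg: "Polynomial.degree ?p = n"
    using assms by (subst diff_conv_add_uminus, subst degree_add_eq_left) (auto simp: degree_monom_eq)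
  then have nz: "?p \<noteq> 0" using assms by auto
  have roots: "{z. poly ?p z = 0} = {z. z ^ n = 1}" by (auto simp: poly_monom)
  show "finite {z :: 'c. z ^ n = 1}" using poly_roots_finite[OF nz] roots by simp
  have "poly (pderiv ?p) z \<noteq> 0" if "poly ?p z = 0" for z
    using that assms by (auto simp: poly_monom pderiv_diff pderiv_monom power_0_left)
  then have "rsquarefree ?p" using rsquarefree_roots by blast
  then have ord: "Polynomial.order z ?p = 0 \<or> Polynomial.order z ?p = 1" for z
    by (simp add: rsquarefree_def)
  have "Polynomial.order z ?p = 1" if "poly ?p z = 0" for z
    using that nz order_root[of ?p z] ord[of z] by auto
  then have "(\<Sum>z | poly ?p z = 0. Polynomial.order z ?p) = (\<Sum>z | poly ?p z = 0. 1)"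
    by (intro sum.cong) auto
  then show "card {z :: 'c. z ^ n = 1} = n"
    using degree_eq_sum_order[OF nz] deg roots by simp
qed

context finite_subfield
begin

lemma units_generator:
  obtains h where "h \<in> K - {0}" "(\<lambda>i. h ^ i) ` {..<Q - 1} = K - {0}" "inj_on (\<lambda>i. h ^ i) {..<Q - 1}"
proof -
  let ?R = "(ring_of_type_algebra :: 'a ring)\<lparr>carrier := K\<rparr>"
  interpret T: Ring.ring "ring_of_type_algebra :: 'a ring"
    using ring_from_type_algebra .
  interpret R: Ring.field ?R using T.subfield_iff(2)[OF subfield_K] .
  have fin: "finite (carrier ?R)" by simp
  obtain h where h: "h \<in> carrier (Multiplicative_Group.mult_of ?R)"
      "carrier (Multiplicative_Group.mult_of ?R) = {h [^]\<^bsub>?R\<^esub> i | i :: nat. i \<in> UNIV}"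
    using R.finite_field_mult_group_has_gen[OF fin] by (rule bexE)
  have carr: "carrier (Multiplicative_Group.mult_of ?R) = K - {0}"
    by (simp add: ring_of_type_algebra_def)
  have pow: "h [^]\<^bsub>?R\<^esub> i = h ^ i" for i :: nat
    by (induction i) (simp_all add: ring_of_type_algebra_def mult.commute)
  have hK: "h \<in> K - {0}" using h(1) unfolding carr .
  have "K - {0} = range (\<lambda>i. h ^ i)" using h(2) unfolding carr pow by auto
  also have "\<dots> = (\<lambda>i. h ^ i) ` {..<Q - 1}"
  proof (intro equalityI subsetI)
    fix y assume "y \<in> range (\<lambda>i. h ^ i)"
    then obtain i where i: "y = h ^ i" by auto
    have "h ^ (i mod (Q - 1) + (Q - 1) * (i div (Q - 1))) = h ^ (i mod (Q - 1))"
      unfolding power_add power_mult units_pow_eq_1[OF hK] by simp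
    then have "y = h ^ (i mod (Q - 1))" by (simp add: i)
    then show "y \<in> (\<lambda>i. h ^ i) ` {..<Q - 1}" using Q_gt_1 by auto
  qed auto
  finally have im: "(\<lambda>i. h ^ i) ` {..<Q - 1} = K - {0}" by simp
  have "inj_on (\<lambda>i. h ^ i) {..<Q - 1}"
    by (rule eq_card_imp_inj_on) (simp, unfold im, simp add: card_K)
  then show thesis using that hK im by blast
qed

text \<open>
  With a generator \<open>h\<close> of the cyclic group of units and \<open>x = h ^ i\<close>, where \<open>0 < i < Q - 1\<close>, send \<open>h\<close> to a
  \<open>\<zeta>\<close> with \<open>\<zeta> ^ (Q - 1) = 1\<close> and \<open>\<zeta> ^ i \<noteq> 1\<close>. It exists because \<open>Z ^ i = 1\<close> has only \<open>i\<close> solutions.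
\<close>

lemma separating_char:
  assumes "x \<in> K - {0}" "x \<noteq> 1"
  obtains \<nu> where "\<nu> \<in> mult_chars K" "\<nu> x \<noteq> 1"
proof -
  obtain h where h: "h \<in> K - {0}" "(\<lambda>i. h ^ i) ` {..<Q - 1} = K - {0}" "inj_on (\<lambda>i. h ^ i) {..<Q - 1}"
    using units_generator by blast
  define lg where "lg = the_inv_into {..<Q - 1} (\<lambda>i. h ^ i)"
  have lg: "h ^ lg y = y" "lg y < Q - 1" if "y \<in> K - {0}" for y
  proof -
    have y: "y \<in> (\<lambda>i. h ^ i) ` {..<Q - 1}" using that h(2) by simp
    show "h ^ lg y = y" "lg y < Q - 1"
      using f_the_inv_into_f[OF h(3) y] the_inv_into_into[OF h(3) y order_refl]
      unfolding lg_def by simp_all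
  qed
  have lg_pow: "lg (h ^ i) = i mod (Q - 1)" for i
  proof -
    have "h ^ (i mod (Q - 1) + (Q - 1) * (i div (Q - 1))) = h ^ (i mod (Q - 1))"
      unfolding power_add power_mult units_pow_eq_1[OF h(1)] by simp
    then have "h ^ i = h ^ (i mod (Q - 1))" by simp
    then show ?thesis
      unfolding lg_def using the_inv_into_f_f[OF h(3), of "i mod (Q - 1)"] Q_gt_1 by simp
  qed
  have "lg x \<noteq> 0" using lg(1)[OF assms(1)] assms(2) by (metis power_0)
  moreover have "lg x < Q - 1" using lg assms by simp
  ultimately have "card {z :: qbar. z ^ lg x = 1} < card {z :: qbar. z ^ (Q - 1) = 1}"
    using card_roots_of_unity(2)[where 'c = qbar] by simp
  then have "\<not> {z :: qbar. z ^ (Q - 1) = 1} \<subseteq> {z. z ^ lg x = 1}"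
    using card_mono card_roots_of_unity(1)[of "lg x"] \<open>lg x \<noteq> 0\<close> by (metis not_less neq0_conv)
  then obtain \<zeta> :: qbar where \<zeta>: "\<zeta> ^ (Q - 1) = 1" "\<zeta> ^ lg x \<noteq> 1" by blast
  define \<nu> where "\<nu> = (\<lambda>y. if y \<in> K - {0} then \<zeta> ^ lg y else 0)"
  have \<zeta>_mod: "\<zeta> ^ (i mod (Q - 1)) = \<zeta> ^ i" for i
  proof -
    have "\<zeta> ^ (i mod (Q - 1) + (Q - 1) * (i div (Q - 1))) = \<zeta> ^ (i mod (Q - 1))"
      unfolding power_add power_mult \<zeta>(1) by simp
    then show ?thesis by simp
  qed
  have "\<zeta> \<noteq> 0" using \<zeta>(1) Q_gt_1 by (auto simp: zero_power)
  moreover have "\<zeta> ^ lg (y * z) = \<zeta> ^ lg y * \<zeta> ^ lg z" if "y \<in> K - {0}" "z \<in> K - {0}" for y z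
  proof -
    have "y * z = h ^ (lg y + lg z)" using lg that by (simp add: power_add)
    then have "\<zeta> ^ lg (y * z) = \<zeta> ^ (lg y + lg z)" using lg_pow \<zeta>_mod by metis
    then show ?thesis by (simp add: power_add)
  qed
  ultimately have "\<nu> \<in> mult_chars K"
    by (auto simp: mult_chars_def \<nu>_def mult_closed)
  moreover have "\<nu> x \<noteq> 1" using \<zeta> assms by (simp add: \<nu>_def)
  ultimately show thesis by (rule that)
qed

lemma finite_chars: "finite (mult_chars K)"
proof (rule finite_subset)
  let ?Z = "{z :: qbar. z ^ (Q - 1) = 1}"
  show "mult_chars K \<subseteq> {f. \<forall>x. (x \<in> K - {0} \<longrightarrow> f x \<in> ?Z) \<and> (x \<notin> K - {0} \<longrightarrow> f x = 0)}"
  proof safe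
    fix \<nu> x assume "\<nu> \<in> mult_chars K" "x \<in> K" "x \<noteq> 0"
    then show "\<nu> x ^ (Q - 1) = 1"
      using char_power[of \<nu> x "Q - 1"] units_pow_eq_1[of x] by simp
  qed (auto simp: char_eq_0_iff)
  show "finite {f. \<forall>x. (x \<in> K - {0} \<longrightarrow> f x \<in> ?Z) \<and> (x \<notin> K - {0} \<longrightarrow> f x = 0)}"
    using Q_gt_1 by (intro finite_set_of_finite_funs card_roots_of_unity(1)) auto
qed

lemma sum_nontriv_char:
  assumes "\<eta> \<in> mult_chars K" "\<eta> \<noteq> triv_char K"
  shows "(\<Sum>x\<in>K - {0}. \<eta> x) = 0"
proof -
  obtain u where u: "u \<in> K - {0}" "\<eta> u \<noteq> 1" using nontriv_char assms by blast
  have "(\<Sum>x\<in>K - {0}. \<eta> x) = (\<Sum>x\<in>K - {0}. \<eta> (u * x))"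
    using sum.reindex_bij_betw[OF units_mult_bij[OF u(1)], of \<eta>] by simp
  also have "\<dots> = \<eta> u * (\<Sum>x\<in>K - {0}. \<eta> x)"
    using u assms by (auto simp: sum_distrib_left char_mult intro!: sum.cong)
  finally have "(1 - \<eta> u) * (\<Sum>x\<in>K - {0}. \<eta> x) = 0" by (simp add: algebra_simps)
  then show ?thesis using u by simp
qed

lemma sum_chars_nontriv:
  assumes "x \<in> K - {0}" "x \<noteq> 1"
  shows "(\<Sum>\<nu>\<in>mult_chars K. \<nu> x) = 0"
proof -
  obtain \<mu> where \<mu>: "\<mu> \<in> mult_chars K" "\<mu> x \<noteq> 1" using separating_char assms by blast
  have inv: "inverse (\<mu> y) * (\<mu> y * \<nu> y) = \<nu> y" "\<mu> y * (inverse (\<mu> y) * \<nu> y) = \<nu> y"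
    if "\<nu> \<in> mult_chars K" for \<nu> y
    using that \<mu>(1) char_eq_0_iff[of \<mu> y] char_eq_0_iff[of \<nu> y] by (cases "y \<in> K - {0}"; force)+
  have "(\<Sum>\<nu>\<in>mult_chars K. \<nu> x) = (\<Sum>\<nu>\<in>mult_chars K. \<mu> x * \<nu> x)"
    by (rule sum.reindex_bij_witness[of _ "\<lambda>\<nu> y. \<mu> y * \<nu> y" "\<lambda>\<nu> y. inverse (\<mu> y) * \<nu> y"])
      (use \<mu> inv in \<open>auto intro!: chars_closed\<close>)
  also have "\<dots> = \<mu> x * (\<Sum>\<nu>\<in>mult_chars K. \<nu> x)" by (simp add: sum_distrib_left)
  finally have "(1 - \<mu> x) * (\<Sum>\<nu>\<in>mult_chars K. \<nu> x) = 0"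
    by (simp add: left_diff_distrib)
  then show ?thesis using \<mu> by simp
qed

lemma of_nat_Q_nonzero: "(of_nat Q :: qbar) \<noteq> 0" "(1 - of_nat Q :: qbar) \<noteq> 0"
  using Q_gt_1 by (auto simp: of_nat_eq_1_iff eq_commute[of 1])

text \<open>
  Sum \<open>\<nu> x\<close> over all \<open>\<nu>\<close> and \<open>x\<close>: only \<open>x = 1\<close> contributes in one order, only the trivial character in the
  other.
\<close>

lemma card_chars: "(of_nat (card (mult_chars K)) :: qbar) = of_nat Q - 1"
proof -
  have "(of_nat (card (mult_chars K)) :: qbar) = (\<Sum>x\<in>{1 :: 'a}. \<Sum>\<nu>\<in>mult_chars K. \<nu> x)"
    by simp
  also have "\<dots> = (\<Sum>x\<in>K - {0}. \<Sum>\<nu>\<in>mult_chars K. \<nu> x)"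
    by (rule sum.mono_neutral_left) (auto intro: sum_chars_nontriv)
  also have "\<dots> = (\<Sum>\<nu>\<in>mult_chars K. \<Sum>x\<in>K - {0}. \<nu> x)"
    by (rule sum.swap)
  also have "\<dots> = (\<Sum>\<nu>\<in>{triv_char K}. \<Sum>x\<in>K - {0}. \<nu> x)"
    by (rule sum.mono_neutral_right) (auto intro: sum_nontriv_char finite_chars chars_closed)
  also have "\<dots> = (\<Sum>x\<in>K - {0}. 1)"
    by (simp add: triv_char_def)
  also have "\<dots> = of_nat Q - 1" using Q_gt_1 by (simp add: card_K of_nat_diff)
  finally show ?thesis .
qed

lemma char_orthogonality:
  assumes "x \<in> K - {0}"
  shows "(\<Sum>\<nu>\<in>mult_chars K. \<nu> x) = (if x = 1 then of_nat Q - 1 else 0)"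
  using sum_chars_nontriv[OF assms] card_chars by simp

lemma char_minus_1:
  assumes "\<eta> \<in> mult_chars K"
  shows "\<eta> (- 1) * \<eta> (- 1) = 1"
  using char_mult[OF assms, of "- 1" "- 1"] assms by (simp add: minus_closed)

end

section \<open>Gauss sums\<close>

locale gauss_sums = finite_subfield Q K for Q :: nat and K :: "'a::field set" +
  fixes \<psi> :: "'a \<Rightarrow> qbar"
  assumes \<psi>: "nontriv_add_char K \<psi>"
begin

lemma \<psi>_add: "x \<in> K \<Longrightarrow> y \<in> K \<Longrightarrow> \<psi> (x + y) = \<psi> x * \<psi> y"
  using \<psi> by (simp add: nontriv_add_char_def)

lemma \<psi>_0: "\<psi> 0 = 1"
  using \<psi>_add[of 0 0] \<psi> by (auto simp: nontriv_add_char_def)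

lemma sum_\<psi>:
  assumes "t \<in> K"
  shows "(\<Sum>x\<in>K. \<psi> (x * t)) = (if t = 0 then of_nat Q else 0)"
proof (cases "t = 0")
  case False
  obtain v where v: "v \<in> K" "\<psi> v \<noteq> 1" using \<psi> by (auto simp: nontriv_add_char_def)
  define u where "u = v / t"
  have u: "u \<in> K" "\<psi> (u * t) \<noteq> 1" using v assms False by (auto simp: u_def divide_closed)
  have "bij_betw ((+) u) K K"
    by (rule bij_betw_byWitness[of _ "\<lambda>x. x - u"]) (auto intro: add_closed diff_closed u)
  then have "(\<Sum>x\<in>K. \<psi> (x * t)) = (\<Sum>x\<in>K. \<psi> ((u + x) * t))"
    using sum.reindex_bij_betw[of "(+) u" K K "\<lambda>x. \<psi> (x * t)"] by simp
  also have "\<dots> = (\<Sum>x\<in>K. \<psi> (u * t) * \<psi> (x * t))"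
    using assms u by (intro sum.cong refl) (simp add: distrib_right \<psi>_add mult_closed)
  also have "\<dots> = \<psi> (u * t) * (\<Sum>x\<in>K. \<psi> (x * t))" by (simp add: sum_distrib_left)
  finally have "(1 - \<psi> (u * t)) * (\<Sum>x\<in>K. \<psi> (x * t)) = 0"
    by (simp add: left_diff_distrib)
  then show ?thesis using u False by simp
qed (simp add: \<psi>_0 card_K)

lemma sum_units_\<psi>:
  assumes "t \<in> K"
  shows "(\<Sum>x\<in>K - {0}. \<psi> (x * t)) = (if t = 0 then of_nat Q else 0) - 1"
proof -
  have "(\<Sum>x\<in>K. \<psi> (x * t)) = 1 + (\<Sum>x\<in>K - {0}. \<psi> (x * t))"
    by (subst sum.remove[of _ 0]) (simp_all add: \<psi>_0)
  then show ?thesis using sum_\<psi>[OF assms] by (simp only: eq_diff_eq add.commute)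
qed

lemma gauss_triv: "gauss K \<psi> (triv_char K) = 1"
proof -
  have "(\<Sum>x\<in>K - {0}. triv_char K x * \<psi> x) = (\<Sum>x\<in>K - {0}. \<psi> (x * 1))"
    by (intro sum.cong) (auto simp: triv_char_def)
  then show ?thesis using sum_units_\<psi>[of 1] by (simp add: gauss_def)
qed

text \<open>
  For \<open>t = 0\<close> the left side vanishes because \<open>\<eta>\<close> is nontrivial, and the right side because \<open>\<eta> 0 = 0\<close> and
  \<open>inverse 0 = 0\<close>.
\<close>

lemma gauss_twist:
  assumes \<eta>: "\<eta> \<in> mult_chars K" "\<eta> \<noteq> triv_char K" and t: "t \<in> K"
  shows "(\<Sum>x\<in>K - {0}. \<eta> x * \<psi> (x * t)) = - inverse (\<eta> t) * gauss K \<psi> \<eta>"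
proof (cases "t = 0")
  case True
  then show ?thesis using sum_nontriv_char[OF \<eta>] \<eta> by (simp add: \<psi>_0)
next
  case False
  then have tu: "t \<in> K - {0}" using t by simp
  have "(\<Sum>x\<in>K - {0}. \<eta> x * \<psi> x) = (\<Sum>x\<in>K - {0}. \<eta> (t * x) * \<psi> (t * x))"
    using sum.reindex_bij_betw[OF units_mult_bij[OF tu], of "\<lambda>x. \<eta> x * \<psi> x"] by simp
  also have "\<dots> = \<eta> t * (\<Sum>x\<in>K - {0}. \<eta> x * \<psi> (x * t))"
    using \<eta> t by (auto simp: sum_distrib_left char_mult mult_ac intro!: sum.cong)
  finally show ?thesis
    using \<eta>(1) tu char_eq_0_iff[OF \<eta>(1), of t] by (simp add: gauss_def)
qed

text \<open>
  Substitute \<open>u = x * s\<close> in the double sum over \<open>x\<close> and \<open>u\<close>.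
\<close>

lemma gauss_product:
  assumes \<alpha>: "\<alpha> \<in> mult_chars K" and \<nu>: "\<nu> \<in> mult_chars K"
  shows "gauss K \<psi> (\<lambda>x. \<alpha> x * \<nu> x) * gauss K \<psi> (\<lambda>x. inverse (\<nu> x)) =
    (\<Sum>s\<in>K - {0}. inverse (\<nu> s) * (\<Sum>x\<in>K - {0}. \<alpha> x * \<psi> (x * (1 + s))))"
proof -
  have "gauss K \<psi> (\<lambda>x. \<alpha> x * \<nu> x) * gauss K \<psi> (\<lambda>x. inverse (\<nu> x)) =
      (\<Sum>x\<in>K - {0}. \<Sum>u\<in>K - {0}. \<alpha> x * \<nu> x * \<psi> x * (inverse (\<nu> u) * \<psi> u))"
    by (simp add: gauss_def sum_product)
  also have "\<dots> = (\<Sum>x\<in>K - {0}. \<Sum>s\<in>K - {0}. inverse (\<nu> s) * (\<alpha> x * \<psi> (x * (1 + s))))"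
  proof (rule sum.cong, rule refl)
    fix x assume x: "x \<in> K - {0}"
    have "(\<Sum>u\<in>K - {0}. \<alpha> x * \<nu> x * \<psi> x * (inverse (\<nu> u) * \<psi> u)) =
        (\<Sum>s\<in>K - {0}. \<alpha> x * \<nu> x * \<psi> x * (inverse (\<nu> (x * s)) * \<psi> (x * s)))"
      using sum.reindex_bij_betw[OF units_mult_bij[OF x],
        of "\<lambda>u. \<alpha> x * \<nu> x * \<psi> x * (inverse (\<nu> u) * \<psi> u)"] by simp
    also have "\<dots> = (\<Sum>s\<in>K - {0}. inverse (\<nu> s) * (\<alpha> x * \<psi> (x * (1 + s))))"
    proof (intro sum.cong refl)
      fix s assume s: "s \<in> K - {0}"
      have "\<psi> (x * (1 + s)) = \<psi> x * \<psi> (x * s)"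
        using x s by (simp add: distrib_left \<psi>_add mult_closed)
      moreover have "\<nu> x \<noteq> 0" using x char_eq_0_iff[OF \<nu>] by simp
      ultimately show "\<alpha> x * \<nu> x * \<psi> x * (inverse (\<nu> (x * s)) * \<psi> (x * s)) =
          inverse (\<nu> s) * (\<alpha> x * \<psi> (x * (1 + s)))"
        using x s \<nu> by (simp add: char_mult field_simps)
    qed
    finally show "(\<Sum>u\<in>K - {0}. \<alpha> x * \<nu> x * \<psi> x * (inverse (\<nu> u) * \<psi> u)) =
        (\<Sum>s\<in>K - {0}. inverse (\<nu> s) * (\<alpha> x * \<psi> (x * (1 + s))))" .
  qed
  also have "\<dots> = (\<Sum>s\<in>K - {0}. \<Sum>x\<in>K - {0}. inverse (\<nu> s) * (\<alpha> x * \<psi> (x * (1 + s))))"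
    by (rule sum.swap)
  finally show ?thesis by (simp add: sum_distrib_left)
qed

text \<open>
  The product of two Gauss sums as a Gauss sum times a Jacobi sum. It serves both to evaluate the
  coefficients of the hypergeometric function and, for a fixed \<open>\<nu>\<close>, to name the Jacobi sum by which they
  are divided.
\<close>

lemma gauss_product_nontriv:
  assumes \<alpha>: "\<alpha> \<in> mult_chars K" "\<alpha> \<noteq> triv_char K" and \<nu>: "\<nu> \<in> mult_chars K"
  shows "gauss K \<psi> (\<lambda>x. \<alpha> x * \<nu> x) * gauss K \<psi> (\<lambda>x. inverse (\<nu> x)) =
    - gauss K \<psi> \<alpha> * (\<Sum>s\<in>K - {0}. inverse (\<nu> s) * inverse (\<alpha> (1 + s)))"
proof -
  have "gauss K \<psi> (\<lambda>x. \<alpha> x * \<nu> x) * gauss K \<psi> (\<lambda>x. inverse (\<nu> x)) =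
    (\<Sum>s\<in>K - {0}. inverse (\<nu> s) * (- inverse (\<alpha> (1 + s)) * gauss K \<psi> \<alpha>))"
    unfolding gauss_product[OF \<alpha>(1) \<nu>]
    by (intro sum.cong refl) (auto simp: gauss_twist[OF \<alpha>] add_closed)
  then show ?thesis by (simp add: sum_distrib_left sum_negf mult_ac)
qed

text \<open>
  The factor \<open>Q ^ \<delta> \<eta>\<close> in \<open>gauss_circ\<close> makes the formula true for the trivial character as well; this
  turns all denominators of the hypergeometric function into numerators.
\<close>

lemma gauss_reflection:
  assumes \<eta>: "\<eta> \<in> mult_chars K"
  shows "gauss_circ K \<psi> \<eta> * gauss K \<psi> (\<lambda>x. inverse (\<eta> x)) = \<eta> (- 1) * of_nat Q"
proof (cases "\<eta> = triv_char K")
  case True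
  have "(\<lambda>x. inverse (triv_char K x)) = triv_char K" by (auto simp: triv_char_def)
  then show ?thesis
    using True gauss_triv minus_closed[of 1]
    by (simp add: gauss_circ_def delta_char_def card_K) (simp add: triv_char_def)
next
  case False
  have inv: "inverse (\<eta> (- 1)) = \<eta> (- 1)" using char_minus_1[OF \<eta>] by (metis inverse_unique)
  have nontriv: "(\<lambda>x. inverse (\<eta> x)) \<noteq> triv_char K"
  proof
    assume "(\<lambda>x. inverse (\<eta> x)) = triv_char K"
    then have "\<eta> x = inverse (triv_char K x)" for x by (metis inverse_inverse_eq)
    then have "\<eta> = triv_char K" by (auto simp: triv_char_def)
    then show False using False by simp
  qed
  have "gauss_circ K \<psi> \<eta> * gauss K \<psi> (\<lambda>x. inverse (\<eta> x)) =
      gauss K \<psi> (\<lambda>x. triv_char K x * \<eta> x) * gauss K \<psi> (\<lambda>x. inverse (\<eta> x))"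
  proof -
    have "(\<lambda>x. triv_char K x * \<eta> x) = \<eta>" using char_eq_0_iff[OF \<eta>] by (auto simp: triv_char_def)
    then show ?thesis using False by (simp add: gauss_circ_def delta_char_def)
  qed
  also have "\<dots> = (\<Sum>s\<in>K - {0}. inverse (\<eta> s) * (\<Sum>x\<in>K - {0}. \<psi> (x * (1 + s))))"
    unfolding gauss_product[OF triv_char_closed \<eta>]
    by (intro sum.cong refl arg_cong2[of _ _ _ _ "(*)"]) (auto simp: triv_char_def)
  also have "\<dots> = (\<Sum>s\<in>K - {0}. (if s = - 1 then inverse (\<eta> s) * of_nat Q else 0) - inverse (\<eta> s))"
  proof (rule sum.cong, rule refl)
    fix s assume "s \<in> K - {0}"
    then have "(\<Sum>x\<in>K - {0}. \<psi> (x * (1 + s))) = (if 1 + s = 0 then of_nat Q else 0) - 1"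
      by (intro sum_units_\<psi> add_closed) auto
    moreover have "1 + s = 0 \<longleftrightarrow> s = - 1" by (metis add_eq_0_iff)
    ultimately show "inverse (\<eta> s) * (\<Sum>x\<in>K - {0}. \<psi> (x * (1 + s))) =
        (if s = - 1 then inverse (\<eta> s) * of_nat Q else 0) - inverse (\<eta> s)"
      by (simp add: right_diff_distrib)
  qed
  also have "\<dots> = inverse (\<eta> (- 1)) * of_nat Q - (\<Sum>s\<in>K - {0}. inverse (\<eta> s))"
    by (simp add: sum_subtractf minus_closed)
  also have "(\<Sum>s\<in>K - {0}. inverse (\<eta> s)) = 0"
    using nontriv by (intro sum_nontriv_char chars_closed \<eta>)
  finally show ?thesis by (simp add: inv)
qed

lemma gauss_nonzero:
  assumes "\<eta> \<in> mult_chars K"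
  shows "gauss K \<psi> \<eta> \<noteq> 0"
proof
  assume "gauss K \<psi> \<eta> = 0"
  then have "\<eta> (- 1) * of_nat Q = 0"
    using gauss_reflection[OF assms] by (simp add: gauss_circ_def)
  moreover have "\<eta> (- 1) \<noteq> 0" using char_minus_1[OF assms] by auto
  ultimately show False using of_nat_Q_nonzero by simp
qed

lemma inverse_gauss_circ:
  assumes "\<eta> \<in> mult_chars K"
  shows "inverse (gauss_circ K \<psi> \<eta>) = gauss K \<psi> (\<lambda>x. inverse (\<eta> x)) * \<eta> (- 1) / of_nat Q"
proof -
  have "gauss_circ K \<psi> \<eta> * (gauss K \<psi> (\<lambda>x. inverse (\<eta> x)) * \<eta> (- 1) / of_nat Q) =
      (gauss_circ K \<psi> \<eta> * gauss K \<psi> (\<lambda>x. inverse (\<eta> x))) * \<eta> (- 1) / of_nat Q"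
    by (simp add: mult_ac)
  also have "\<dots> = (\<eta> (- 1) * \<eta> (- 1)) * (of_nat Q / of_nat Q)"
    unfolding gauss_reflection[OF assms] by simp
  also have "\<dots> = 1" using of_nat_Q_nonzero char_minus_1[OF assms] by simp
  finally show ?thesis by (rule inverse_unique)
qed

end

section \<open>The hypergeometric function as a quotient of character sums\<close>

context gauss_sums
begin

text \<open>
  By the reflection formula \<open>1 / gauss_circ \<nu>\<close> is a multiple of the Gauss sum of \<open>\<nu>\<inverse>\<close>. The signs
  \<open>\<nu> (- 1)\<close> cancel, and the coefficient is, up to a constant, the product of the four Gauss sums of
  \<open>\<alpha>\<nu>\<close>, \<open>\<nu>\<inverse>\<close>, \<open>\<beta>\<nu>\<close> and \<open>(\<gamma>\<nu>)\<inverse>\<close>. They are paired in this order: the product of the characters is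
  \<open>\<alpha>\<close> in the first pair and \<open>B = \<beta> / \<gamma>\<close> in the second, so that both pairs are instances of
  \<open>gauss_product_nontriv\<close>. The constant is a pair of the second kind, with \<open>\<gamma>\<close> in the place of \<open>\<gamma>\<nu>\<close>.
\<close>

lemma hypergeom_term:
  assumes \<alpha>: "\<alpha> \<in> mult_chars K" "\<alpha> \<noteq> triv_char K" and \<beta>: "\<beta> \<in> mult_chars K"
    and \<gamma>: "\<gamma> \<in> mult_chars K" and ne: "(\<lambda>x. \<beta> x * inverse (\<gamma> x)) \<noteq> triv_char K"
    and \<nu>: "\<nu> \<in> mult_chars K"
  shows "poch K \<psi> \<alpha> \<nu> * poch K \<psi> \<beta> \<nu> / (poch_circ K \<psi> (triv_char K) \<nu> * poch_circ K \<psi> \<gamma> \<nu>) =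
    - ((\<Sum>s\<in>K - {0}. inverse (\<nu> s) * inverse (\<alpha> (1 + s))) *
       (\<Sum>t\<in>K - {0}. inverse (\<gamma> t * \<nu> t) * (\<gamma> (1 + t) * inverse (\<beta> (1 + t))))) /
    (\<Sum>t\<in>K - {0}. inverse (\<gamma> t) * (\<gamma> (1 + t) * inverse (\<beta> (1 + t))))"
    "(\<Sum>t\<in>K - {0}. inverse (\<gamma> t) * (\<gamma> (1 + t) * inverse (\<beta> (1 + t)))) \<noteq> 0"
proof -
  define B where "B = (\<lambda>x. \<beta> x * inverse (\<gamma> x))"
  have B: "B \<in> mult_chars K" "B \<noteq> triv_char K"
    using \<beta> \<gamma> ne by (auto simp: B_def intro: chars_closed)
  have inv_B: "inverse (B x) = \<gamma> x * inverse (\<beta> x)" for x by (simp add: B_def)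
  have B_\<gamma>: "(\<lambda>x. B x * \<gamma> x) = \<beta>"
    using char_eq_0_iff[OF \<beta>] char_eq_0_iff[OF \<gamma>] by (force simp: B_def)
  have B_\<gamma>\<nu>: "(\<lambda>x. B x * (\<gamma> x * \<nu> x)) = (\<lambda>x. \<beta> x * \<nu> x)"
    using fun_cong[OF B_\<gamma>] by (simp flip: mult.assoc)
  have triv_\<nu>: "(\<lambda>x. triv_char K x * \<nu> x) = \<nu>"
    using char_eq_0_iff[OF \<nu>] by (auto simp: triv_char_def)
  have \<gamma>\<nu>: "(\<lambda>x. \<gamma> x * \<nu> x) \<in> mult_chars K" using \<gamma> \<nu> by (rule chars_closed)
  let ?g = "gauss K \<psi>" and ?c = "gauss_circ K \<psi>" and ?q = "of_nat Q :: qbar"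
  let ?S1 = "\<Sum>s\<in>K - {0}. inverse (\<nu> s) * inverse (\<alpha> (1 + s))"
  let ?S2 = "\<Sum>t\<in>K - {0}. inverse (\<gamma> t * \<nu> t) * (\<gamma> (1 + t) * inverse (\<beta> (1 + t)))"
  let ?J = "\<Sum>t\<in>K - {0}. inverse (\<gamma> t) * (\<gamma> (1 + t) * inverse (\<beta> (1 + t)))"
  have e1: "?g (\<lambda>x. \<alpha> x * \<nu> x) * ?g (\<lambda>x. inverse (\<nu> x)) = - ?g \<alpha> * ?S1"
    by (rule gauss_product_nontriv[OF \<alpha> \<nu>])
  have e2: "?g (\<lambda>x. \<beta> x * \<nu> x) * ?g (\<lambda>x. inverse (\<gamma> x * \<nu> x)) = - ?g B * ?S2"
    using gauss_product_nontriv[OF B \<gamma>\<nu>] unfolding B_\<gamma>\<nu> inv_B .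
  have e3: "?g \<beta> * ?g (\<lambda>x. inverse (\<gamma> x)) = - ?g B * ?J"
    using gauss_product_nontriv[OF B \<gamma>] unfolding B_\<gamma> inv_B .
  have g_inv: "?g (\<lambda>x. inverse (\<gamma> x)) \<noteq> 0" by (intro gauss_nonzero chars_closed \<gamma>)
  have nz: "?g \<alpha> \<noteq> 0" "?g \<beta> \<noteq> 0" "?g B \<noteq> 0" using gauss_nonzero \<alpha> \<beta> B by auto
  show J: "?J \<noteq> 0" using e3 g_inv nz by auto
  have signs: "\<gamma> (- 1) * \<gamma> (- 1) = 1" "\<nu> (- 1) * \<nu> (- 1) = 1" using char_minus_1 \<gamma> \<nu> by auto
  have c_triv: "?c (triv_char K) = ?q"
    by (simp add: gauss_circ_def delta_char_def gauss_triv card_K)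
  have c_\<gamma>: "?c \<gamma> = \<gamma> (- 1) * ?q / ?g (\<lambda>x. inverse (\<gamma> x))"
    using gauss_reflection[OF \<gamma>] g_inv by (simp add: field_simps)
  have poch: "poch K \<psi> \<alpha> \<nu> = ?g (\<lambda>x. \<alpha> x * \<nu> x) / ?g \<alpha>"
      "poch K \<psi> \<beta> \<nu> = ?g (\<lambda>x. \<beta> x * \<nu> x) / ?g \<beta>"
      "poch_circ K \<psi> (triv_char K) \<nu> = ?c \<nu> / ?c (triv_char K)"
      "poch_circ K \<psi> \<gamma> \<nu> = ?c (\<lambda>x. \<gamma> x * \<nu> x) / ?c \<gamma>"
    by (simp_all add: poch_def poch_circ_def char_group_def triv_\<nu>)
  have "poch K \<psi> \<alpha> \<nu> * poch K \<psi> \<beta> \<nu> / (poch_circ K \<psi> (triv_char K) \<nu> * poch_circ K \<psi> \<gamma> \<nu>) =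
      ?g (\<lambda>x. \<alpha> x * \<nu> x) * ?g (\<lambda>x. \<beta> x * \<nu> x) * ?c (triv_char K) * ?c \<gamma> *
      inverse (?c \<nu>) * inverse (?c (\<lambda>x. \<gamma> x * \<nu> x)) / (?g \<alpha> * ?g \<beta>)"
    unfolding poch by (simp add: divide_inverse mult_ac)
  also have "\<dots> = (?g (\<lambda>x. \<alpha> x * \<nu> x) * ?g (\<lambda>x. inverse (\<nu> x))) *
      (?g (\<lambda>x. \<beta> x * \<nu> x) * ?g (\<lambda>x. inverse (\<gamma> x * \<nu> x))) *
      ((\<gamma> (- 1) * \<gamma> (- 1)) * (\<nu> (- 1) * \<nu> (- 1))) * (?q / ?q) * (?q / ?q) /
      (?g \<alpha> * (?g \<beta> * ?g (\<lambda>x. inverse (\<gamma> x))))"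
    unfolding c_triv c_\<gamma> inverse_gauss_circ[OF \<nu>] inverse_gauss_circ[OF \<gamma>\<nu>]
    by (simp only: divide_inverse inverse_mult_distrib mult_ac)
  also have "\<dots> = - (?S1 * ?S2) / ?J"
    unfolding e1 e2 e3 signs using nz J of_nat_Q_nonzero by (simp add: field_simps)
  finally show "poch K \<psi> \<alpha> \<nu> * poch K \<psi> \<beta> \<nu> /
      (poch_circ K \<psi> (triv_char K) \<nu> * poch_circ K \<psi> \<gamma> \<nu>) = - (?S1 * ?S2) / ?J" .
qed

lemma sum_units_reflect:
  assumes "f 0 = (0 :: qbar)"
  shows "(\<Sum>s\<in>K - {0}. f s) = (\<Sum>x\<in>K. f (- x))"
proof -
  have "(\<Sum>s\<in>K - {0}. f s) = (\<Sum>s\<in>K. f s)"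
    using assms by (intro sum.mono_neutral_left) auto
  also have "\<dots> = (\<Sum>x\<in>K. f (- x))"
    by (rule sum.reindex_bij_witness[of _ uminus uminus]) (auto intro: minus_closed)
  finally show ?thesis .
qed

text \<open>
  By \<open>hypergeom_term\<close> the coefficient of \<open>\<nu> z\<close> is a sum over \<open>s\<close> and \<open>t\<close> in which \<open>\<nu>\<close> occurs only as
  \<open>1 / \<nu> (s * t)\<close>. Orthogonality then leaves the terms with \<open>t = z / s\<close>. The final substitution
  \<open>s = - x\<close> brings both sums into the form of \<open>char_sums_power_sums\<close>.
\<close>

lemma hypergeom_2F1_char_sum:
  assumes \<alpha>: "\<alpha> \<in> mult_chars K" "\<alpha> \<noteq> triv_char K" and \<beta>: "\<beta> \<in> mult_chars K"
    and \<gamma>: "\<gamma> \<in> mult_chars K" and ne: "(\<lambda>x. \<beta> x * inverse (\<gamma> x)) \<noteq> triv_char K"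
    and z: "z \<in> K - {0}"
  shows "hypergeom K \<psi> [\<alpha>, \<beta>] [triv_char K, \<gamma>] z =
    (\<Sum>x\<in>K. \<beta> (0 - x) * inverse (\<alpha> (1 - x)) * (\<gamma> (z - x) * inverse (\<beta> (z - x)))) /
    (\<gamma> z * (\<Sum>x\<in>K. inverse (\<gamma> (0 - x)) * (\<gamma> (1 - x) * inverse (\<beta> (1 - x)))))"
proof -
  let ?\<delta> = "\<lambda>x. \<gamma> x * inverse (\<beta> x)"
  let ?J = "\<Sum>t\<in>K - {0}. inverse (\<gamma> t) * ?\<delta> (1 + t)"
  have J: "?J \<noteq> 0" by (rule hypergeom_term(2)[OF \<alpha> \<beta> \<gamma> ne \<alpha>(1)])
  have point: "(\<Sum>t\<in>K - {0}. inverse (\<gamma> t) * ?\<delta> (1 + t) *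
        (\<Sum>\<nu>\<in>mult_chars K. \<nu> z * inverse (\<nu> s) * inverse (\<nu> t))) =
      (of_nat Q - 1) * (inverse (\<gamma> z) * (\<beta> s * ?\<delta> (z + s)))" if s: "s \<in> K - {0}" for s
  proof -
    have zs: "z / s \<in> K - {0}" using z s by (simp add: divide_closed)
    have "(\<Sum>\<nu>\<in>mult_chars K. \<nu> z * inverse (\<nu> s) * inverse (\<nu> t)) =
        (if t = z / s then of_nat Q - 1 else 0)" if t: "t \<in> K - {0}" for t
    proof -
      have mem: "z / (s * t) \<in> K - {0}" using z s t by (simp add: divide_closed mult_closed)
      have "(\<Sum>\<nu>\<in>mult_chars K. \<nu> z * inverse (\<nu> s) * inverse (\<nu> t)) =
          (\<Sum>\<nu>\<in>mult_chars K. \<nu> (z / (s * t)))"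
        using z s t
        by (intro sum.cong refl) (simp add: char_divide char_mult mult_closed, simp add: divide_inverse mult_ac)
      also have "\<dots> = (if t = z / s then of_nat Q - 1 else 0)"
        using s t by (subst char_orthogonality[OF mem]) (auto simp: field_simps)
      finally show ?thesis .
    qed
    then have "(\<Sum>t\<in>K - {0}. inverse (\<gamma> t) * ?\<delta> (1 + t) *
        (\<Sum>\<nu>\<in>mult_chars K. \<nu> z * inverse (\<nu> s) * inverse (\<nu> t))) =
        (\<Sum>t\<in>K - {0}. if t = z / s then inverse (\<gamma> t) * ?\<delta> (1 + t) * (of_nat Q - 1) else 0)"
      by (intro sum.cong refl) auto
    also have "\<dots> = inverse (\<gamma> (z / s)) * ?\<delta> (1 + z / s) * (of_nat Q - 1)"
      using zs by simp
    also have "1 + z / s = (z + s) / s" using s by (simp add: field_simps)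
    also have "inverse (\<gamma> (z / s)) * ?\<delta> ((z + s) / s) = inverse (\<gamma> z) * (\<beta> s * ?\<delta> (z + s))"
    proof -
      have zs': "z + s \<in> K" using z s by (simp add: add_closed)
      have "\<gamma> s \<noteq> 0" "\<beta> s \<noteq> 0" "\<gamma> z \<noteq> 0"
        using s z char_eq_0_iff[OF \<gamma>] char_eq_0_iff[OF \<beta>] by auto
      then show ?thesis
        using s z zs' \<beta> \<gamma> by (simp add: char_divide) (simp add: field_simps)
    qed
    finally show ?thesis by (simp add: mult_ac)
  qed
  have "(\<Sum>\<nu>\<in>mult_chars K. (\<Prod>\<alpha>\<leftarrow>[\<alpha>, \<beta>]. poch K \<psi> \<alpha> \<nu>) /
        (\<Prod>\<beta>\<leftarrow>[triv_char K, \<gamma>]. poch_circ K \<psi> \<beta> \<nu>) * \<nu> z) =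
      (\<Sum>\<nu>\<in>mult_chars K. - ((\<Sum>s\<in>K - {0}. inverse (\<nu> s) * inverse (\<alpha> (1 + s))) *
        (\<Sum>t\<in>K - {0}. inverse (\<gamma> t * \<nu> t) * ?\<delta> (1 + t))) / ?J * \<nu> z)"
    by (intro sum.cong refl) (simp add: hypergeom_term(1)[OF \<alpha> \<beta> \<gamma> ne])
  also have "\<dots> = - (\<Sum>\<nu>\<in>mult_chars K. \<Sum>s\<in>K - {0}. \<Sum>t\<in>K - {0}.
      inverse (\<alpha> (1 + s)) * (inverse (\<gamma> t) * ?\<delta> (1 + t) * (\<nu> z * inverse (\<nu> s) * inverse (\<nu> t)))) / ?J"
    unfolding sum_product
    by (simp add: sum_distrib_left sum_distrib_right sum_negf mult_ac divide_inverse)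
  also have "(\<Sum>\<nu>\<in>mult_chars K. \<Sum>s\<in>K - {0}. \<Sum>t\<in>K - {0}.
      inverse (\<alpha> (1 + s)) * (inverse (\<gamma> t) * ?\<delta> (1 + t) * (\<nu> z * inverse (\<nu> s) * inverse (\<nu> t)))) =
      (\<Sum>s\<in>K - {0}. \<Sum>\<nu>\<in>mult_chars K. \<Sum>t\<in>K - {0}.
      inverse (\<alpha> (1 + s)) * (inverse (\<gamma> t) * ?\<delta> (1 + t) * (\<nu> z * inverse (\<nu> s) * inverse (\<nu> t))))"
    by (rule sum.swap)
  also have "\<dots> = (\<Sum>s\<in>K - {0}. \<Sum>t\<in>K - {0}. \<Sum>\<nu>\<in>mult_chars K.
      inverse (\<alpha> (1 + s)) * (inverse (\<gamma> t) * ?\<delta> (1 + t) * (\<nu> z * inverse (\<nu> s) * inverse (\<nu> t))))"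
    by (rule sum.cong[OF refl], rule sum.swap)
  also have "\<dots> = (\<Sum>s\<in>K - {0}. inverse (\<alpha> (1 + s)) *
      ((of_nat Q - 1) * (inverse (\<gamma> z) * (\<beta> s * ?\<delta> (z + s)))))"
    by (rule sum.cong[OF refl], subst point[symmetric]) (auto simp: sum_distrib_left)
  also have "\<dots> = (of_nat Q - 1) * inverse (\<gamma> z) *
      (\<Sum>s\<in>K - {0}. \<beta> s * inverse (\<alpha> (1 + s)) * ?\<delta> (z + s))"
    by (simp add: sum_distrib_left mult_ac)
  also have "(\<Sum>s\<in>K - {0}. \<beta> s * inverse (\<alpha> (1 + s)) * ?\<delta> (z + s)) =
      (\<Sum>x\<in>K. \<beta> (0 - x) * inverse (\<alpha> (1 - x)) * ?\<delta> (z - x))"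
    by (subst sum_units_reflect) (simp_all add: \<beta>)
  finally have "hypergeom K \<psi> [\<alpha>, \<beta>] [triv_char K, \<gamma>] z =
      1 / (1 - of_nat Q) * (- ((of_nat Q - 1) * inverse (\<gamma> z) *
      (\<Sum>x\<in>K. \<beta> (0 - x) * inverse (\<alpha> (1 - x)) * ?\<delta> (z - x))) / ?J)"
    unfolding hypergeom_def card_K by (rule arg_cong)
  also have "\<dots> = (\<Sum>x\<in>K. \<beta> (0 - x) * inverse (\<alpha> (1 - x)) * ?\<delta> (z - x)) / (\<gamma> z * ?J)"
  proof -
    have alg: "1 / w * (- (w' * inverse g * S) / J) = S / (g * J)"
      if "w \<noteq> 0" "w' = - w" for w w' g S J :: qbar
      using that by (simp add: divide_inverse mult_ac)
    show ?thesis by (rule alg) (use of_nat_Q_nonzero in simp_all)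
  qed
  also have "?J = (\<Sum>x\<in>K. inverse (\<gamma> (0 - x)) * ?\<delta> (1 - x))"
    by (subst sum_units_reflect) (simp_all add: \<gamma>)
  finally show ?thesis .
qed

end

section \<open>Hypergeometric values over extensions\<close>

lemma (in base_field) lift_char_hom:
  assumes "finite_field (q ^ s) l" "s > 0"
  shows "lift_char q s l \<in> hom (char_group k) (char_group l)"
  using lift_char_mult_chars[OF assms]
  by (auto simp: hom_def char_group_def lift_char_def fun_eq_iff)

lemma (in base_field) lift_triv_char:
  assumes "finite_field (q ^ s) l" "s > 0"
  shows "lift_char q s l (triv_char k) = triv_char l"
  using ff_norm_in_base[OF assms(1)] ff_norm_eq_0_iff[OF assms(2)]
  by (auto simp: lift_char_def triv_char_def fun_eq_iff)

text \<open>
  The points \<open>0, 1, z\<close> carry \<open>\<beta>\<close>, \<open>1 / \<alpha>\<close> and \<open>\<gamma> / \<beta>\<close> in the numerator, and \<open>0, 1\<close> carry \<open>1 / \<gamma>\<close> and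
  \<open>\<gamma> / \<beta>\<close> in the denominator. In both cases \<open>\<gamma> / \<beta>\<close> is nontrivial. The numerator is
  \<open>- (u ^ s + v ^ s)\<close>, the Jacobi sum is \<open>- (j ^ s)\<close>, and \<open>\<gamma> z\<close> becomes \<open>\<gamma> z ^ s\<close> because \<open>z\<close> lies in the
  base field; so the reciprocal roots are \<open>u / (\<gamma> z * j)\<close> and \<open>v / (\<gamma> z * j)\<close>.
\<close>

lemma (in base_field) hypergeom_power_sums:
  assumes \<alpha>: "\<alpha> \<in> mult_chars k" "\<alpha> \<noteq> triv_char k" and \<beta>: "\<beta> \<in> mult_chars k"
    and \<gamma>: "\<gamma> \<in> mult_chars k" "\<beta> \<noteq> \<gamma>" and z: "z \<in> k - {0, 1}"
  obtains u v :: qbar where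
    "\<And>s l \<psi>. s > 0 \<Longrightarrow> finite_field (q ^ s) l \<Longrightarrow> k \<subseteq> l \<Longrightarrow> nontriv_add_char l \<psi> \<Longrightarrow>
       hypergeom l \<psi> [lift_char q s l \<alpha>, lift_char q s l \<beta>]
         [triv_char l, lift_char q s l \<gamma>] z = u ^ s + v ^ s"
proof -
  define \<delta> where "\<delta> = (\<lambda>x. \<gamma> x * inverse (\<beta> x))"
  define \<eta> where "\<eta> = (\<lambda>p :: 'a. if p = 0 then \<beta> else if p = 1 then (\<lambda>x. inverse (\<alpha> x)) else \<delta>)"
  define \<eta>' where "\<eta>' = (\<lambda>p :: 'a. if p = 0 then (\<lambda>x. inverse (\<gamma> x)) else \<delta>)"
  have ne: "(\<lambda>x. \<beta> x * inverse (\<gamma> x)) \<noteq> triv_char k"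
  proof
    assume eq: "(\<lambda>x. \<beta> x * inverse (\<gamma> x)) = triv_char k"
    have "\<beta> x = \<gamma> x" for x
      using fun_cong[OF eq, of x] char_eq_0_iff[OF \<beta>, of x] char_eq_0_iff[OF \<gamma>(1), of x]
      by (cases "x \<in> k - {0}") (auto simp: triv_char_def field_simps)
    then show False using \<gamma> by auto
  qed
  have ne': "\<delta> \<noteq> triv_char k"
  proof
    assume "\<delta> = triv_char k"
    then have "inverse (\<beta> x * inverse (\<gamma> x)) = triv_char k x" for x
      by (auto simp: \<delta>_def fun_eq_iff mult.commute)
    then have "\<beta> x * inverse (\<gamma> x) = triv_char k x" for x
      by (metis inverse_inverse_eq inverse_1 inverse_zero triv_char_def)
    then show False using ne by auto
  qed
  have \<delta>: "\<delta> \<in> mult_chars k" unfolding \<delta>_def by (intro chars_closed \<beta> \<gamma>)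
  have z': "z \<noteq> 0" "z \<noteq> 1" "z \<in> k" using z by auto
  obtain u v where uv: "\<And>s l. s > 0 \<Longrightarrow> finite_field (q ^ s) l \<Longrightarrow> k \<subseteq> l \<Longrightarrow>
       (\<Sum>x\<in>l. \<Prod>p\<in>{0, 1, z}. lift_char q s l (\<eta> p) (p - x)) = - (u ^ s + v ^ s)"
    by (rule char_sums_power_sums[of "{0, 1, z}" \<eta> z])
      (use z' \<beta> \<alpha> \<delta> ne' in \<open>auto simp: \<eta>_def chars_closed card_insert_if\<close>)
  obtain j j' where j: "\<And>s l. s > 0 \<Longrightarrow> finite_field (q ^ s) l \<Longrightarrow> k \<subseteq> l \<Longrightarrow>
       (\<Sum>x\<in>l. \<Prod>p\<in>{0, 1}. lift_char q s l (\<eta>' p) (p - x)) = - (j ^ s + j' ^ s)"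
       "card {0, 1 :: 'a} \<le> 2 \<Longrightarrow> j' = 0"
    by (rule char_sums_power_sums[of "{0, 1}" \<eta>' 1])
      (use \<gamma> \<delta> ne' in \<open>auto simp: \<eta>'_def chars_closed card_insert_if\<close>)
  have lift_inv: "lift_char q s l (\<lambda>x. inverse (\<chi> x)) y = inverse (lift_char q s l \<chi> y)"
    and lift_mult: "lift_char q s l (\<lambda>x. \<chi> x * \<mu> x) y = lift_char q s l \<chi> y * lift_char q s l \<mu> y"
    for s l \<chi> \<mu> and y :: 'a
    by (auto simp: lift_char_def)
  show thesis
  proof (rule that[of "u / (\<gamma> z * j)" "v / (\<gamma> z * j)"])
    fix s l \<psi> assume l: "s > 0" "finite_field (q ^ s) l" "k \<subseteq> l" and \<psi>: "nontriv_add_char l \<psi>"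
    interpret l: gauss_sums "q ^ s" l \<psi> using l \<psi> by unfold_locales
    let ?L = "lift_char q s l"
    have lift_z: "?L \<gamma> z = \<gamma> z ^ s"
      using z' l \<gamma> by (auto simp: lift_char_def ff_norm_base char_power)
    have "?L (\<lambda>x. \<beta> x * inverse (\<gamma> x)) = (\<lambda>x. ?L \<beta> x * inverse (?L \<gamma> x))"
      by (rule ext) (simp add: lift_char_def)
    then have "?L \<alpha> \<noteq> triv_char l" "(\<lambda>x. ?L \<beta> x * inverse (?L \<gamma> x)) \<noteq> triv_char l"
      using lift_char_nontriv[OF l(2,1,3) \<alpha>] lift_char_nontriv[OF l(2,1,3) _ ne] \<beta> \<gamma>
      by (simp_all add: chars_closed)
    then have "hypergeom l \<psi> [?L \<alpha>, ?L \<beta>] [triv_char l, ?L \<gamma>] z =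
        (\<Sum>x\<in>l. ?L \<beta> (0 - x) * inverse (?L \<alpha> (1 - x)) * (?L \<gamma> (z - x) * inverse (?L \<beta> (z - x)))) /
        (?L \<gamma> z * (\<Sum>x\<in>l. inverse (?L \<gamma> (0 - x)) * (?L \<gamma> (1 - x) * inverse (?L \<beta> (1 - x)))))"
      using z' l by (intro l.hypergeom_2F1_char_sum lift_char_mult_chars \<alpha> \<beta> \<gamma>) auto
    also have "(\<Sum>x\<in>l. ?L \<beta> (0 - x) * inverse (?L \<alpha> (1 - x)) * (?L \<gamma> (z - x) * inverse (?L \<beta> (z - x)))) =
        - (u ^ s + v ^ s)"
      unfolding uv[OF l, symmetric] using z'
      by (intro sum.cong refl) (simp add: \<eta>_def \<delta>_def lift_inv lift_mult mult.assoc)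
    also have "(\<Sum>x\<in>l. inverse (?L \<gamma> (0 - x)) * (?L \<gamma> (1 - x) * inverse (?L \<beta> (1 - x)))) =
        - (j ^ s + j' ^ s)"
      unfolding j(1)[OF l, symmetric]
      by (intro sum.cong refl) (simp add: \<eta>'_def \<delta>_def lift_inv lift_mult)
    also have "- (u ^ s + v ^ s) / (?L \<gamma> z * - (j ^ s + j' ^ s)) =
        (u / (\<gamma> z * j)) ^ s + (v / (\<gamma> z * j)) ^ s"
      using j(2) l(1) by (simp add: lift_z zero_power power_divide power_mult_distrib
          flip: add_divide_distrib del: minus_add_distrib)
    finally show "hypergeom l \<psi> [?L \<alpha>, ?L \<beta>] [triv_char l, ?L \<gamma>] z =
        (u / (\<gamma> z * j)) ^ s + (v / (\<gamma> z * j)) ^ s" .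
  qed
qed

section \<open>Power sum polynomials and traces\<close>

text \<open>
  The recursion comes from \<open>\<alpha> ^ (n + 2) + \<beta> ^ (n + 2) = x * (\<alpha> ^ (n + 1) + \<beta> ^ (n + 1)) - y * (\<alpha> ^ n + \<beta> ^ n)\<close>
  with \<open>x = \<alpha> + \<beta>\<close> and \<open>y = \<alpha> * \<beta>\<close>. Multiplication by the inner variable \<open>x\<close> is \<open>pCons 0\<close> on each coefficient,
  and multiplication by the outer variable \<open>y\<close> is \<open>pCons 0\<close> itself.
\<close>

fun waring_poly :: "nat \<Rightarrow> int poly poly" where
  "waring_poly 0 = [:[:2:]:]"
| "waring_poly (Suc 0) = [:[:0, 1:]:]"
| "waring_poly (Suc (Suc n)) = map_poly (pCons 0) (waring_poly (Suc n)) - pCons 0 (waring_poly n)"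

lemma eval2_waring_poly:
  fixes \<alpha> \<beta> :: "'c :: comm_ring_1"
  shows "eval2 (waring_poly n) (\<alpha> + \<beta>) (\<alpha> * \<beta>) = \<alpha> ^ n + \<beta> ^ n"
proof (induction n rule: waring_poly.induct)
  case (3 n)
  let ?x = "\<alpha> + \<beta>" and ?y = "\<alpha> * \<beta>"
  let ?f = "\<lambda>p. poly (map_poly of_int p) ?x"
  have shift: "eval2 (map_poly (pCons 0) P) ?x ?y = ?x * eval2 P ?x ?y" for P
  proof -
    have "map_poly ?f (map_poly (pCons 0) P) = smult ?x (map_poly ?f P)"
      by (intro poly_eqI) (simp add: coeff_map_poly map_poly_pCons)
    then show ?thesis by (simp add: eval2_def)
  qed
  have pCons: "eval2 (pCons 0 P) ?x ?y = ?y * eval2 P ?x ?y" for P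
    by (simp add: eval2_def map_poly_pCons)
  have diff: "eval2 (P - R) ?x ?y = eval2 P ?x ?y - eval2 R ?x ?y" for P R
  proof -
    have "map_poly of_int (p - r) = (map_poly of_int p - map_poly of_int r :: 'c poly)" for p r
      by (intro poly_eqI) (simp add: coeff_map_poly)
    then have "map_poly ?f (P - R) = map_poly ?f P - map_poly ?f R"
      by (intro poly_eqI) (simp add: coeff_map_poly)
    then show ?thesis by (simp add: eval2_def)
  qed
  show ?case using 3 by (simp add: shift pCons diff algebra_simps)
qed (simp_all add: eval2_def map_poly_pCons)

text \<open>
  A ring of characteristic zero is infinite, so a polynomial is determined by its values; apply this
  first to \<open>y\<close> and then to \<open>x\<close>.
\<close>

lemma eval2_eqI:
  assumes "\<And>x y :: 'c :: {idom, ring_char_0}. eval2 P x y = eval2 R x y"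
  shows "P = R"
proof (intro poly_eqI)
  fix i j
  let ?f = "\<lambda>x :: 'c. \<lambda>p. poly (map_poly of_int p) x"
  have "map_poly (?f x) P = map_poly (?f x) R" for x
    using assms by (intro poly_eq_poly_eq_iff[THEN iffD1] ext) (simp add: eval2_def)
  then have "?f x (Polynomial.coeff P i) = ?f x (Polynomial.coeff R i)" for x
    by (metis (no_types, lifting) coeff_map_poly map_poly_0 poly_0)
  then have "(map_poly of_int (Polynomial.coeff P i) :: 'c poly) = map_poly of_int (Polynomial.coeff R i)"
    by (intro poly_eq_poly_eq_iff[THEN iffD1] ext)
  then have "(of_int (Polynomial.coeff (Polynomial.coeff P i) j) :: 'c) = of_int (Polynomial.coeff (Polynomial.coeff R i) j)"
    by (metis coeff_map_poly of_int_0)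
  then show "Polynomial.coeff (Polynomial.coeff P i) j = Polynomial.coeff (Polynomial.coeff R i) j"
    by simp
qed

lemma alg_closed_sum_prod:
  fixes x y :: "'c :: alg_closed_field"
  obtains \<alpha> \<beta> where "x = \<alpha> + \<beta>" "y = \<alpha> * \<beta>"
proof -
  obtain \<alpha> where "poly [:y, - x, 1:] \<alpha> = 0"
    using alg_closed_imp_poly_has_root[of "[:y, - x, 1:]"] by auto
  then have "y = \<alpha> * (x - \<alpha>)" by (simp add: algebra_simps eq_neg_iff_add_eq_0)
  then show thesis by (intro that[of \<alpha> "x - \<alpha>"]) auto
qed

text \<open>
  Uniqueness holds because every pair \<open>(x, y)\<close> is of the form \<open>(\<alpha> + \<beta>, \<alpha> * \<beta>)\<close>.
\<close>

lemma power_sum_poly_eq: "power_sum_poly r = waring_poly r"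
  unfolding power_sum_poly_def
proof (rule the_equality)
  fix P assume P: "\<forall>\<alpha> \<beta> :: qbar. eval2 P (\<alpha> + \<beta>) (\<alpha> * \<beta>) = \<alpha> ^ r + \<beta> ^ r"
  have "eval2 P x y = eval2 (waring_poly r) x y" for x y :: qbar
    by (rule alg_closed_sum_prod[of x y]) (simp add: P eval2_waring_poly)
  then show "P = waring_poly r" by (rule eval2_eqI)
qed (simp add: eval2_waring_poly)

theorem theorem1p2:
  fixes d q r :: nat
    and a b c :: int
    and k k2 kr :: "'a::field set"
    and \<psi> \<psi>2 \<psi>r \<phi> \<phi>2 \<phi>r :: "'a \<Rightarrow> qbar"
    and lam :: 'a
  assumes "d \<ge> 2" and "primepow q" and "d dvd q - 1" and "r \<ge> 1"
    and "finite_field q k"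
    and "finite_field (q ^ 2) k2" and "k \<subseteq> k2"
    and "finite_field (q ^ r) kr" and "k \<subseteq> kr"
    and "nontriv_add_char k \<psi>" and "nontriv_add_char k2 \<psi>2" and "nontriv_add_char kr \<psi>r"
    and "\<phi> \<in> mult_chars k" and "group.ord (char_group k) \<phi> = d"
    and "\<phi>2 = lift_char q 2 k2 \<phi>" and "\<phi>r = lift_char q r kr \<phi>"
    and "\<not> [a = 0] (mod int d)" and "\<not> [a = c] (mod int d)"
    and "\<not> [b = 0] (mod int d)" and "\<not> [b = c] (mod int d)"
    and "\<not> [c = 0] (mod int d)"
    and "[c - a - b = int (d * (d - 1) div 2)] (mod int d)"
    and "lam \<in> (k - {0}) - mu d k"
    and "F1 = hypergeom k \<psi>
             [\<phi> [^]\<^bsub>char_group k\<^esub> a, \<phi> [^]\<^bsub>char_group k\<^esub> b]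
             [triv_char k, \<phi> [^]\<^bsub>char_group k\<^esub> c] (lam ^ d)"
    and "F2 = hypergeom k2 \<psi>2
             [\<phi>2 [^]\<^bsub>char_group k2\<^esub> a, \<phi>2 [^]\<^bsub>char_group k2\<^esub> b]
             [lift_char q 2 k2 (triv_char k), \<phi>2 [^]\<^bsub>char_group k2\<^esub> c] (lam ^ d)"
    and "Fr = hypergeom kr \<psi>r
             [\<phi>r [^]\<^bsub>char_group kr\<^esub> a, \<phi>r [^]\<^bsub>char_group kr\<^esub> b]
             [lift_char q r kr (triv_char k), \<phi>r [^]\<^bsub>char_group kr\<^esub> c] (lam ^ d)"
  shows "Fr = eval2 (power_sum_poly r) F1 ((F1 ^ 2 - F2) / 2)"
proof -
  note ff = assms(5) and ff2 = assms(6) and ffr = assms(8)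
  interpret base_field q k using ff assms(2) by unfold_locales
  interpret G: comm_group "char_group k" using comm_group_char_group[OF ff] .
  have \<phi>: "\<phi> \<in> carrier (char_group k)" using assms(13) by (simp add: char_group_def)
  define \<theta> where "\<theta> = (\<lambda>n :: int. \<phi> [^]\<^bsub>char_group k\<^esub> n)"
  have \<theta>_closed: "\<theta> n \<in> mult_chars k" for n
    using G.int_pow_closed[OF \<phi>, of n] by (simp add: \<theta>_def char_group_def)
  have \<theta>_triv: "\<theta> n = triv_char k \<longleftrightarrow> [n = 0] (mod int d)" for n
    using G.int_pow_eq_id[OF \<phi>, of n] assms(14)
    by (simp add: \<theta>_def char_group_def cong_0_iff)
  have \<theta>_eq: "\<theta> m = \<theta> n \<Longrightarrow> [m = n] (mod int d)" for m n
  proof -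
    assume "\<theta> m = \<theta> n"
    then have "\<theta> (m - n) = \<one>\<^bsub>char_group k\<^esub>"
      using \<phi> unfolding \<theta>_def by (simp add: G.int_pow_diff)
    then show ?thesis using \<theta>_triv[of "m - n"] by (simp add: char_group_def cong_diff_iff_cong_0)
  qed
  have \<theta>_lift: "lift_char q s l \<phi> [^]\<^bsub>char_group l\<^esub> n = lift_char q s l (\<theta> n)"
    if "finite_field (q ^ s) l" "s > 0" for s l n
    using hom_int_pow[OF lift_char_hom[OF that] \<phi> G.group_axioms
        comm_group.axioms(2)[OF comm_group_char_group[OF that(1)]]]
    by (simp add: \<theta>_def)
  have "lam ^ d \<in> k - {0, 1}"
    using assms(23) by (auto simp: mu_def intro: pow_closed)
  moreover have "\<theta> a \<noteq> triv_char k" "\<theta> b \<noteq> \<theta> c"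
    using \<theta>_triv \<theta>_eq assms(17,20) by auto
  ultimately obtain u v where uv:
    "\<And>s l \<psi>. s > 0 \<Longrightarrow> finite_field (q ^ s) l \<Longrightarrow> k \<subseteq> l \<Longrightarrow> nontriv_add_char l \<psi> \<Longrightarrow>
       hypergeom l \<psi> [lift_char q s l (\<theta> a), lift_char q s l (\<theta> b)]
         [triv_char l, lift_char q s l (\<theta> c)] (lam ^ d) = u ^ s + v ^ s"
    using hypergeom_power_sums[of "\<theta> a" "\<theta> b" "\<theta> c" "lam ^ d"] \<theta>_closed by metis
  have "lift_char q 1 k (\<theta> n) = \<theta> n" for n
    using char_eq_0_iff[OF \<theta>_closed[of n]] by (auto simp: lift_char_def ff_norm_def fun_eq_iff)
  then have F1: "F1 = u + v"
    using uv[of 1 k \<psi>] ff assms(10) unfolding assms(24) \<theta>_def by simp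
  have F2: "F2 = u ^ 2 + v ^ 2"
    unfolding assms(15,25) using uv[OF _ ff2 assms(7,11)] by (simp add: \<theta>_lift[OF ff2] lift_triv_char[OF ff2])
  have Fr: "Fr = u ^ r + v ^ r"
    unfolding assms(16,26) using uv[OF _ ffr assms(9,12)] assms(4)
    by (simp add: \<theta>_lift[OF ffr] lift_triv_char[OF ffr])
  have "(F1 ^ 2 - F2) / 2 = u * v" unfolding F1 F2 by (simp add: power2_eq_square algebra_simps)
  then show ?thesis unfolding power_sum_poly_eq Fr F1 by (simp add: eval2_waring_poly)
qed

end
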